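(* Let $H=H(\mathcal D)$ be the Hopf algebra of a simply linked datum of nilpotent type (see context). For every $\gamma\in\widehat G$, $$\dim L(\gamma)=\prod_{k\notin S(\gamma)}m_k\prod_{j\in S(\gamma)}(e_j+1).$$
   Context: $\Bbbk$ is a field of characteristic $0$ containing all roots of $1$, $G$ a finite abelian group, $\widehat G=\mathrm{Hom}(G,\Bbbk^\times)$, $\underline n=\{1,\dots,n\}$. Datum and $H$: $a_i,b_i\in G$, $\chi_i\in\widehat G$ ($i\in\underline n$) satisfy $a_ib_i\ne 1$ for all $i$; $\chi_j(a_i)=\chi_i(b_j)$ for all $i,j$; $\chi_i(a_j)\chi_j(a_i)=1$ and $\chi_i(b_j)\chi_j(b_i)=1$ for all $i\neq j$. Put $q_{ij}=\chi_j(a_i)$, $q_i=\chi_i(a_i)$, $m_i$ = the multiplicative order of $q_i$, with $m_i\ge 2$. $H=H(\mathcal D)$ is the Hopf algebra generated by $G$ and $x_i,y_i$ ($i\in\underline n$) with the relations of $G$ and: $gx_i=\chi_i(g)x_ig$, $gy_i=\chi_i^{-1}(g)y_ig$ for $g\in G$; $x_ix_j=q_{ij}x_jx_i$, $y_iy_j=q_{ij}y_jy_i$ for $i\ne j$; $x_iy_j-q_{ij}^{-1}y_jx_i=\delta_{ij}(a_ib_i-1)$ for all $i,j$; $x_i^{m_i}=0=y_i^{m_i}$. Elements of $G$ are grouplike, $\Delta x_i=a_i\otimes x_i+x_i\otimes 1$, $\Delta y_i=b_i\otimes y_i+y_i\otimes 1$. Modules: $Y$ is the subalgebra of $H$ generated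 by $G$ and all $y_i$. For $\gamma\in\widehat G$, $\Bbbk_\gamma=\Bbbk 1_\gamma$ is the $Y$-module with $g1_\gamma=\gamma(g)1_\gamma$, $y_i1_\gamma=0$, and $Z(\gamma)=H\otimes_Y\Bbbk_\gamma$. $Z(\gamma)$ has a unique maximal submodule $R(\gamma)$, and $L(\gamma)=Z(\gamma)/R(\gamma)$. $S(\gamma)$ is the set of $j\in\underline n$ such that $\gamma(a_jb_j)=q_j^{-e_j}$ for some (necessarily unique) integer $0\le e_j\le m_j-2$; $e_j$ denotes this integer. *)

theory Defs
  imports
    "HOL-Algebra.Generated_Rings"
    "HOL-Algebra.Free_Abelian_Groups"
    "HOL-Algebra.Multiplicative_Group"
    "Jordan_Normal_Form.VS_Connect"
begin

text \<open>Modules over rings that need not be commutative. The record type of modules is the one of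
  \<^theory>\<open>HOL-Algebra.Module\<close>, whose locale \<open>module\<close> requires a commutative ring.
  In all module records below the fields \<open>mult\<close> and \<open>one\<close> are meaningless.\<close>

locale left_module = R?: ring R + M?: abelian_group M
    for R :: "('r, 's) ring_scheme" (structure) and M :: "('r, 'v, 't) module_scheme" (structure) +
  assumes smult_closed:
      "\<lbrakk>r \<in> carrier R; v \<in> carrier M\<rbrakk> \<Longrightarrow> r \<odot>\<^bsub>M\<^esub> v \<in> carrier M"
    and smult_l_distr:
      "\<lbrakk>r \<in> carrier R; s \<in> carrier R; v \<in> carrier M\<rbrakk> \<Longrightarrow>
        (r \<oplus> s) \<odot>\<^bsub>M\<^esub> v = r \<odot>\<^bsub>M\<^esub> v \<oplus>\<^bsub>M\<^esub> s \<odot>\<^bsub>M\<^esub> v"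
    and smult_r_distr:
      "\<lbrakk>r \<in> carrier R; v \<in> carrier M; w \<in> carrier M\<rbrakk> \<Longrightarrow>
        r \<odot>\<^bsub>M\<^esub> (v \<oplus>\<^bsub>M\<^esub> w) = r \<odot>\<^bsub>M\<^esub> v \<oplus>\<^bsub>M\<^esub> r \<odot>\<^bsub>M\<^esub> w"
    and smult_assoc:
      "\<lbrakk>r \<in> carrier R; s \<in> carrier R; v \<in> carrier M\<rbrakk> \<Longrightarrow>
        (r \<otimes> s) \<odot>\<^bsub>M\<^esub> v = r \<odot>\<^bsub>M\<^esub> (s \<odot>\<^bsub>M\<^esub> v)"
    and smult_one:
      "v \<in> carrier M \<Longrightarrow> \<one> \<odot>\<^bsub>M\<^esub> v = v"

text \<open>\<open>submodule\<close> is qualified because VectorSpace has another predicate of that name, which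
  presupposes a commutative ring.\<close>

definition maximal_submodule ::
    "('r, 's) ring_scheme \<Rightarrow> ('r, 'v, 't) module_scheme \<Rightarrow> 'v set \<Rightarrow> bool" where
  "maximal_submodule R M N \<longleftrightarrow>
     Module.submodule N R M \<and> N \<noteq> carrier M \<and>
     (\<forall>N'. Module.submodule N' R M \<and> N \<subseteq> N' \<longrightarrow> N' = N \<or> N' = carrier M)"

definition quotient_module ::
    "('r, 'v, 't) module_scheme \<Rightarrow> 'v set \<Rightarrow> ('r, 'v set) module" where
  "quotient_module M N =
     \<lparr>carrier = a_rcosets\<^bsub>M\<^esub> N, mult = undefined, one = undefined,
      ring.zero = N, add = set_add M,
      smult = (\<lambda>r C. \<Union>v\<in>C. N +>\<^bsub>M\<^esub> (r \<odot>\<^bsub>M\<^esub> v))\<rparr>"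

definition restrict_scalars ::
    "('k \<Rightarrow> 'r) \<Rightarrow> ('r, 'v, 't) module_scheme \<Rightarrow> ('k, 'v) module" where
  "restrict_scalars \<phi> M =
     \<lparr>carrier = carrier M, mult = undefined, one = undefined,
      ring.zero = \<zero>\<^bsub>M\<^esub>, add = add M, smult = (\<lambda>c v. \<phi> c \<odot>\<^bsub>M\<^esub> v)\<rparr>"

text \<open>The tensor product of \<open>R\<close>, as a right module over its subring \<open>S\<close>, with a left
  \<open>S\<close>-module \<open>N\<close>: the free abelian group on pairs \<open>(r, v)\<close> modulo biadditivity and
  \<open>S\<close>-balancedness, with \<open>R\<close> acting on the left factor.\<close>

definition tensor_relations ::
    "('r, 's) ring_scheme \<Rightarrow> 'r set \<Rightarrow> ('r, 'v, 't) module_scheme \<Rightarrow> ('r \<times> 'v \<Rightarrow>\<^sub>0 int) set" where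
  "tensor_relations R S N =
     {frag_of (r \<oplus>\<^bsub>R\<^esub> r', v) - frag_of (r, v) - frag_of (r', v) | r r' v.
        r \<in> carrier R \<and> r' \<in> carrier R \<and> v \<in> carrier N} \<union>
     {frag_of (r, v \<oplus>\<^bsub>N\<^esub> v') - frag_of (r, v) - frag_of (r, v') | r v v'.
        r \<in> carrier R \<and> v \<in> carrier N \<and> v' \<in> carrier N} \<union>
     {frag_of (r \<otimes>\<^bsub>R\<^esub> s, v) - frag_of (r, s \<odot>\<^bsub>N\<^esub> v) | r s v.
        r \<in> carrier R \<and> s \<in> S \<and> v \<in> carrier N}"

definition induced_module ::
    "('r, 's) ring_scheme \<Rightarrow> 'r set \<Rightarrow> ('r, 'v, 't) module_scheme \<Rightarrow>
     ('r, ('r \<times> 'v \<Rightarrow>\<^sub>0 int) set) module" where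
  "induced_module R S N =
     (let F = free_Abelian_group (carrier R \<times> carrier N);
          T = generate F (tensor_relations R S N)
      in \<lparr>carrier = carrier (F Mod T), mult = undefined, one = undefined,
          ring.zero = \<one>\<^bsub>F Mod T\<^esub>, add = mult (F Mod T),
          smult = (\<lambda>r C. \<Union>f\<in>C. T #>\<^bsub>F\<^esub> frag_extend (\<lambda>(r', v). frag_of (r \<otimes>\<^bsub>R\<^esub> r', v)) f)\<rparr>)"

text \<open>Finitely supported functions on a monoid carry the convolution product, so those on words
  form the free unital algebra.\<close>

instantiation list :: (type) monoid_add
begin

definition zero_list :: "'a list" where "zero_list = []"
definition plus_list :: "'a list \<Rightarrow> 'a list \<Rightarrow> 'a list" where "plus_list = append"

instance by standard (simp_all add: zero_list_def plus_list_def)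

end

definition free_algebra :: "'x set \<Rightarrow> ('x list \<Rightarrow>\<^sub>0 'k::field) ring" where
  "free_algebra A =
     \<lparr>carrier = {f. Poly_Mapping.keys f \<subseteq> lists A}, mult = (*), one = 1, ring.zero = 0, add = (+)\<rparr>"

definition letter :: "'x \<Rightarrow> ('x list \<Rightarrow>\<^sub>0 'k::field)" where
  "letter x = Poly_Mapping.single [x] 1"

definition fconst :: "'k::field \<Rightarrow> ('x list \<Rightarrow>\<^sub>0 'k)" where
  "fconst c = Poly_Mapping.single [] c"

text \<open>All polynomials \<open>X ^ N - 1\<close> with \<open>N > 0\<close> split into linear factors.\<close>

definition contains_roots_of_unity :: "'k::field itself \<Rightarrow> bool" where
  "contains_roots_of_unity _ \<longleftrightarrow>
     (\<forall>N>0. \<exists>zs :: 'k list. monom 1 N - 1 = (\<Prod>z\<leftarrow>zs. [:- z, 1:]))"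

definition characters :: "('g, 's) monoid_scheme \<Rightarrow> ('g \<Rightarrow> 'k::field) set" where
  "characters G = hom G (units_of class_ring)"

text \<open>The data \<open>G\<close>, \<open>n\<close>, \<open>a\<^sub>i\<close>, \<open>b\<^sub>i\<close>, \<open>\<chi>\<^sub>i\<close>; the families only matter on \<open>{1..n}\<close>.
  The matrix \<open>q\<^sub>i\<^sub>j\<close> is \<open>qm\<close>, its diagonal entries are the \<open>q\<^sub>i\<close>, and \<open>m\<^sub>i\<close> is \<open>mord\<close>.\<close>

record ('g, 'k) datum =
  grp :: "'g monoid"
  rnk :: nat
  elA :: "nat \<Rightarrow> 'g"
  elB :: "nat \<Rightarrow> 'g"
  chr :: "nat \<Rightarrow> 'g \<Rightarrow> 'k"

definition qm :: "('g, 'k::field) datum \<Rightarrow> nat \<Rightarrow> nat \<Rightarrow> 'k" where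
  "qm D i j = chr D j (elA D i)"

definition mord :: "('g, 'k::field) datum \<Rightarrow> nat \<Rightarrow> nat" where
  "mord D i = group.ord (units_of (class_ring :: 'k ring)) (qm D i i)"

definition simply_linked_datum :: "('g, 'k::field) datum \<Rightarrow> bool" where
  "simply_linked_datum D \<longleftrightarrow>
     comm_group (grp D) \<and> finite (carrier (grp D)) \<and>
     (\<forall>i\<in>{1..rnk D}.
        elA D i \<in> carrier (grp D) \<and> elB D i \<in> carrier (grp D) \<and> chr D i \<in> characters (grp D) \<and>
        elA D i \<otimes>\<^bsub>grp D\<^esub> elB D i \<noteq> \<one>\<^bsub>grp D\<^esub> \<and> mord D i \<ge> 2) \<and>
     (\<forall>i\<in>{1..rnk D}. \<forall>j\<in>{1..rnk D}. chr D j (elA D i) = chr D i (elB D j)) \<and>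
     (\<forall>i\<in>{1..rnk D}. \<forall>j\<in>{1..rnk D}. i \<noteq> j \<longrightarrow>
        chr D i (elA D j) * chr D j (elA D i) = 1 \<and>
        chr D i (elB D j) * chr D j (elB D i) = 1)"

datatype 'g generator = gen_G 'g | gen_X nat | gen_Y nat

definition generators :: "('g, 'k) datum \<Rightarrow> 'g generator set" where
  "generators D =
     gen_G ` carrier (grp D) \<union> gen_X ` {1..rnk D} \<union> gen_Y ` {1..rnk D}"

definition H_relations :: "('g, 'k::field) datum \<Rightarrow> ('g generator list \<Rightarrow>\<^sub>0 'k) set" where
  "H_relations D =
     (let G = grp D; I = {1..rnk D}; g = (\<lambda>h. letter (gen_G h)); x = (\<lambda>i. letter (gen_X i));
          y = (\<lambda>i. letter (gen_Y i)) in
      {g \<one>\<^bsub>G\<^esub> - 1} \<union>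
      {g h * g h' - g (h \<otimes>\<^bsub>G\<^esub> h') | h h'. h \<in> carrier G \<and> h' \<in> carrier G} \<union>
      {g h * x i - fconst (chr D i h) * x i * g h | h i. h \<in> carrier G \<and> i \<in> I} \<union>
      {g h * y i - fconst (inverse (chr D i h)) * y i * g h | h i. h \<in> carrier G \<and> i \<in> I} \<union>
      {x i * x j - fconst (qm D i j) * x j * x i | i j. i \<in> I \<and> j \<in> I \<and> i \<noteq> j} \<union>
      {y i * y j - fconst (qm D i j) * y j * y i | i j. i \<in> I \<and> j \<in> I \<and> i \<noteq> j} \<union>
      {x i * y j - fconst (inverse (qm D i j)) * y j * x i
         - (if i = j then g (elA D i \<otimes>\<^bsub>G\<^esub> elB D i) - 1 else 0) | i j. i \<in> I \<and> j \<in> I} \<union>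
      {x i ^ mord D i | i. i \<in> I} \<union>
      {y i ^ mord D i | i. i \<in> I})"

definition H_ideal :: "('g, 'k::field) datum \<Rightarrow> ('g generator list \<Rightarrow>\<^sub>0 'k) set" where
  "H_ideal D = genideal (free_algebra (generators D)) (H_relations D)"

text \<open>The underlying algebra of the Hopf algebra; modules, and hence all that follows, do not
  involve its coalgebra structure.\<close>

definition H_alg :: "('g, 'k::field) datum \<Rightarrow> ('g generator list \<Rightarrow>\<^sub>0 'k) set ring" where
  "H_alg D = free_algebra (generators D) Quot H_ideal D"

definition H_class ::
    "('g, 'k::field) datum \<Rightarrow> ('g generator list \<Rightarrow>\<^sub>0 'k) \<Rightarrow> ('g generator list \<Rightarrow>\<^sub>0 'k) set" where
  "H_class D f = H_ideal D +>\<^bsub>free_algebra (generators D)\<^esub> f"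

text \<open>The structure map of the algebra over its ground field, through which modules over the
  algebra become vector spaces.\<close>

definition H_scalar :: "('g, 'k::field) datum \<Rightarrow> 'k \<Rightarrow> ('g generator list \<Rightarrow>\<^sub>0 'k) set" where
  "H_scalar D c = H_class D (fconst c)"

definition Y_set :: "('g, 'k::field) datum \<Rightarrow> ('g generator list \<Rightarrow>\<^sub>0 'k) set set" where
  "Y_set D = generate_ring (H_alg D)
     (range (H_scalar D) \<union> (\<lambda>h. H_class D (letter (gen_G h))) ` carrier (grp D)
        \<union> (\<lambda>i. H_class D (letter (gen_Y i))) ` {1..rnk D})"

definition Y_alg :: "('g, 'k::field) datum \<Rightarrow> ('g generator list \<Rightarrow>\<^sub>0 'k) set ring" where
  "Y_alg D = (H_alg D)\<lparr>carrier := Y_set D\<rparr>"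

text \<open>The one-dimensional module attached to a character \<open>\<gamma>\<close> has the field itself as underlying
  space, with \<open>1\<close> in the role of the basis vector \<open>1\<^sub>\<gamma>\<close>. Its action is pinned down by the
  action of the generators; being extensional makes it unique as a HOL function.\<close>

definition line :: "('r \<Rightarrow> 'k \<Rightarrow> 'k) \<Rightarrow> ('r, 'k::field) module" where
  "line act = \<lparr>carrier = UNIV, mult = undefined, one = undefined,
     ring.zero = 0, add = (+), smult = act\<rparr>"

definition K_action ::
    "('g, 'k::field) datum \<Rightarrow> ('g \<Rightarrow> 'k) \<Rightarrow> ('g generator list \<Rightarrow>\<^sub>0 'k) set \<Rightarrow> 'k \<Rightarrow> 'k" where
  "K_action D \<gamma> = (THE act.
     act \<in> extensional (Y_set D) \<and> left_module (Y_alg D) (line act) \<and>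
     (\<forall>c v. act (H_scalar D c) v = c * v) \<and>
     (\<forall>h\<in>carrier (grp D). act (H_class D (letter (gen_G h))) 1 = \<gamma> h) \<and>
     (\<forall>i\<in>{1..rnk D}. act (H_class D (letter (gen_Y i))) 1 = 0))"

definition K_mod ::
    "('g, 'k::field) datum \<Rightarrow> ('g \<Rightarrow> 'k) \<Rightarrow> (('g generator list \<Rightarrow>\<^sub>0 'k) set, 'k) module" where
  "K_mod D \<gamma> = line (K_action D \<gamma>)"

definition Z_mod ::
    "('g, 'k::field) datum \<Rightarrow> ('g \<Rightarrow> 'k) \<Rightarrow>
     (('g generator list \<Rightarrow>\<^sub>0 'k) set, (('g generator list \<Rightarrow>\<^sub>0 'k) set \<times> 'k \<Rightarrow>\<^sub>0 int) set) module"
  where "Z_mod D \<gamma> = induced_module (H_alg D) (Y_set D) (K_mod D \<gamma>)"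

definition R_sub ::
    "('g, 'k::field) datum \<Rightarrow> ('g \<Rightarrow> 'k) \<Rightarrow> (('g generator list \<Rightarrow>\<^sub>0 'k) set \<times> 'k \<Rightarrow>\<^sub>0 int) set set"
  where "R_sub D \<gamma> = (THE N. maximal_submodule (H_alg D) (Z_mod D \<gamma>) N)"

definition L_mod ::
    "('g, 'k::field) datum \<Rightarrow> ('g \<Rightarrow> 'k) \<Rightarrow>
     (('g generator list \<Rightarrow>\<^sub>0 'k) set, (('g generator list \<Rightarrow>\<^sub>0 'k) set \<times> 'k \<Rightarrow>\<^sub>0 int) set set) module"
  where "L_mod D \<gamma> = quotient_module (Z_mod D \<gamma>) (R_sub D \<gamma>)"

text \<open>\<open>is_exponent D \<gamma> j e\<close>: \<open>e\<close> qualifies as the integer \<open>e\<^sub>j\<close>. The bound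
  \<open>e \<le> m\<^sub>j - 2\<close> is written without subtraction.\<close>

definition is_exponent :: "('g, 'k::field) datum \<Rightarrow> ('g \<Rightarrow> 'k) \<Rightarrow> nat \<Rightarrow> nat \<Rightarrow> bool" where
  "is_exponent D \<gamma> j e \<longleftrightarrow>
     e + 2 \<le> mord D j \<and> \<gamma> (elA D j \<otimes>\<^bsub>grp D\<^esub> elB D j) = qm D j j powi (- int e)"

definition S_set :: "('g, 'k::field) datum \<Rightarrow> ('g \<Rightarrow> 'k) \<Rightarrow> nat set" where
  "S_set D \<gamma> = {j \<in> {1..rnk D}. \<exists>e. is_exponent D \<gamma> j e}"

definition e_exp :: "('g, 'k::field) datum \<Rightarrow> ('g \<Rightarrow> 'k) \<Rightarrow> nat \<Rightarrow> nat" where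
  "e_exp D \<gamma> j = (THE e. is_exponent D \<gamma> j e)"

end

theory Submission
  imports Defs "HOL-Library.Function_Algebras"
begin

text \<open>The simple module \<open>L(\<gamma>)\<close> can be written down explicitly. If \<open>v\<close> is a vector killed by all \<open>y\<^sub>i\<close> on
  which \<open>G\<close> acts through \<open>\<gamma>\<close>, then \<open>y\<^sub>i\<close> sends \<open>x\<^sub>i\<^sup>s v\<close> to \<open>c\<^sub>i(s) x\<^sub>i\<^sup>s\<^sup>-\<^sup>1 v\<close> with
  \<open>c\<^sub>i(s) = (1 + q\<^sub>i + \<dots> + q\<^sub>i\<^sup>s\<^sup>-\<^sup>1) (q\<^sub>i - \<gamma>(a\<^sub>i b\<^sub>i) q\<^sub>i\<^sup>s)\<close>. The first factor vanishes exactly when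
  \<open>m\<^sub>i\<close> divides \<open>s\<close>, the second exactly when \<open>\<gamma>(a\<^sub>i b\<^sub>i) = q\<^sub>i\<close> to the power \<open>1 - s\<close>. So the least positive
  zero \<open>d\<^sub>i\<close> of \<open>c\<^sub>i\<close> is \<open>e\<^sub>i + 1\<close> if \<open>i \<in> S(\<gamma>)\<close> and \<open>m\<^sub>i\<close> otherwise, and the monomials
  \<open>x\<^sup>\<alpha> v\<close> with \<open>\<alpha>\<^sub>i < d\<^sub>i\<close> should be a basis of \<open>L(\<gamma>)\<close>. Their number is the asserted dimension.

  This is turned into a proof as follows. Functions on multi-indices carry an action of the free
  algebra by weighted shifts that is modelled on these formulas, and all defining relations of \<open>H\<close>
  act as zero (\<open>relations_act\<close>). On the functions supported in the box \<open>\<alpha>\<^sub>i < d\<^sub>i\<close>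
  the action is irreducible: as \<open>c\<^sub>i(s) \<noteq> 0\<close> inside the box, the \<open>y\<^sub>i\<close> bring every nonzero
  function down to a multiple of the delta function \<open>v\<^sub>0\<close> at the origin (\<open>act_reaches_v0\<close>), and the
  \<open>x\<^sub>i\<close> recover everything from \<open>v\<^sub>0\<close> (\<open>boxed_reached\<close>). The vector \<open>v\<^sub>0\<close> also shows that the character of
  \<open>Y\<close> defining \<open>k\<^sub>\<gamma>\<close> exists (\<open>K_action_eq\<close>), and it yields a homomorphism \<open>\<theta>\<close> from \<open>Z(\<gamma>)\<close>
  with \<open>p 1\<^sub>\<gamma> \<mapsto> p v\<^sub>0\<close> (\<open>obtain_theta\<close>).

  It remains to see that the kernel of \<open>\<theta>\<close> contains every proper submodule; then it is \<open>R(\<gamma>)\<close> and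
  the quotient is the space of functions on the box. Weights cannot be used for this, because
  \<open>x\<^sup>\<alpha> 1\<^sub>\<gamma>\<close> may have weight \<open>\<gamma>\<close> for some \<open>\<alpha> \<noteq> 0\<close>. Instead, pull a submodule back to a left ideal
  \<open>N\<close> of the free algebra. If \<open>N\<close> has an element not killing \<open>v\<^sub>0\<close>, a left multiple \<open>p\<close> of it
  satisfies \<open>p v\<^sub>0 = v\<^sub>0\<close>. Moving all \<open>y\<^sub>i\<close> and all group elements to the right replaces \<open>p\<close> by a
  combination \<open>s\<close> of words in the \<open>x\<^sub>i\<close> (\<open>normal_form\<close>), and \<open>s v\<^sub>0 = v\<^sub>0\<close> forces the constant term
  of \<open>s\<close> to be 1. Since long words in the \<open>x\<^sub>i\<close> vanish in \<open>H\<close> (\<open>long_word_zero\<close>), such an \<open>s\<close> is 1 plus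
  a nilpotent element, hence a unit, and \<open>1 \<in> N\<close> (\<open>one_in_highest_weight\<close>).\<close>

section \<open>Free algebras acting on functions\<close>

text \<open>Vectors are functions from here on. Their sums are evaluated at a point only on demand, so that
  the simplifier treats operators on them as linear maps.\<close>
declare plus_fun_apply [simp del] zero_fun_apply [simp del]

lemmas fun_apply_simps = plus_fun_apply zero_fun_apply minus_apply uminus_apply

lemma poly_mapping_sum_single:
  "p = (\<Sum>w\<in>Poly_Mapping.keys p. Poly_Mapping.single w (Poly_Mapping.lookup p w))"
proof (rule poly_mapping_eqI)
  fix v
  have "(\<Sum>w\<in>Poly_Mapping.keys p. Poly_Mapping.lookup (Poly_Mapping.single w (Poly_Mapping.lookup p w)) v)
      = (\<Sum>w\<in>Poly_Mapping.keys p. if w = v then Poly_Mapping.lookup p v else 0)"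
    by (rule sum.cong) (auto simp: lookup_single)
  then show "Poly_Mapping.lookup p v =
      Poly_Mapping.lookup (\<Sum>w\<in>Poly_Mapping.keys p. Poly_Mapping.single w (Poly_Mapping.lookup p w)) v"
    by (simp add: lookup_sum in_keys_iff)
qed

lemma poly_mapping_keys_induct [consumes 1, case_names zero single add]:
  fixes p :: "'a \<Rightarrow>\<^sub>0 'b::comm_monoid_add"
  assumes "Poly_Mapping.keys p \<subseteq> W"
    and "P 0" and "\<And>w c. w \<in> W \<Longrightarrow> P (Poly_Mapping.single w c)"
    and "\<And>p q. P p \<Longrightarrow> P q \<Longrightarrow> P (p + q)"
  shows "P p"
proof -
  have "P (\<Sum>w\<in>V. Poly_Mapping.single w (Poly_Mapping.lookup p w))" if "V \<subseteq> Poly_Mapping.keys p" for V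
    using finite_subset[OF that finite_keys] that assms by (induction V rule: finite_induct) auto
  then show ?thesis
    by (subst poly_mapping_sum_single) simp
qed

lemma mult_single_list:
  "Poly_Mapping.single u (a::'k::field) * Poly_Mapping.single v b = Poly_Mapping.single (u @ v) (a * b)"
  by (simp add: mult_single plus_list_def)

lemma single_Nil_one: "Poly_Mapping.single [] (1::'k::field) = 1"
  by (simp add: zero_list_def flip: single_one)

lemma fconst_commute: "fconst c * p = p * fconst (c::'k::field)"
  using subset_UNIV
  by (induction p rule: poly_mapping_keys_induct)
    (auto simp: fconst_def mult_single_list algebra_simps)

lemma fconst_simps:
  "fconst (a + b) = fconst a + fconst (b::'k::field)" "fconst (a * b) = fconst a * fconst b"
  "fconst (0::'k) = 0" "fconst (1::'k) = 1" "fconst (- a) = - fconst a"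
  by (simp_all add: fconst_def single_add mult_single_list single_Nil_one single_uminus)

lemma single_Cons: "Poly_Mapping.single (x # w) (c::'k::field) = letter x * Poly_Mapping.single w c"
  by (simp add: letter_def mult_single_list)

lemma single_eq_fconst_mult:
  "Poly_Mapping.single w (c::'k::field) = fconst c * Poly_Mapping.single w 1"
  by (simp add: fconst_def mult_single_list)

definition fscale :: "'k::field \<Rightarrow> ('i \<Rightarrow> 'k) \<Rightarrow> 'i \<Rightarrow> 'k" where
  "fscale c f = (\<lambda>\<beta>. c * f \<beta>)"

lemma fscale_simps [simp]:
  "fscale c (f + g) = fscale c f + fscale c g" "fscale c (0 :: 'i \<Rightarrow> 'k::field) = 0"
  "fscale (a + b) f = fscale a f + fscale b f" "fscale a (fscale b f) = fscale (a * b) f"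
  "fscale 0 f = 0" "fscale 1 f = f" "fscale c (- f) = - fscale c f" "fscale c (f - g) = fscale c f - fscale c g"
  by (auto simp: fscale_def fun_eq_iff algebra_simps fun_apply_simps)

lemma fscale_sum: "fscale c (sum F A) = (\<Sum>x\<in>A. fscale c (F x))"
  by (induction A rule: infinite_finite_induct) simp_all

text \<open>A choice of one linear operator for each letter extends to a representation of the free algebra,
  in which words act by composition.\<close>
locale operator_family =
  fixes \<rho> :: "'x \<Rightarrow> ('i \<Rightarrow> 'k::field) \<Rightarrow> 'i \<Rightarrow> 'k"
  assumes op_add: "\<rho> x (f + g) = \<rho> x f + \<rho> x g"
    and op_scale: "\<rho> x (fscale c f) = fscale c (\<rho> x f)"
begin

definition act :: "('x list \<Rightarrow>\<^sub>0 'k) \<Rightarrow> ('i \<Rightarrow> 'k) \<Rightarrow> 'i \<Rightarrow> 'k" where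
  "act p f = (\<Sum>w\<in>Poly_Mapping.keys p. fscale (Poly_Mapping.lookup p w) (foldr \<rho> w f))"

lemma foldr_add: "foldr \<rho> w (f + g) = foldr \<rho> w f + foldr \<rho> w g"
  by (induction w) (simp_all add: op_add)

lemma foldr_scale: "foldr \<rho> w (fscale c f) = fscale c (foldr \<rho> w f)"
  by (induction w) (simp_all add: op_scale)

lemma act_single: "act (Poly_Mapping.single w c) f = fscale c (foldr \<rho> w f)"
  by (simp add: act_def)

lemma act_0 [simp]: "act 0 f = 0"
  by (simp add: act_def)

lemma act_add [simp]: "act (p + q) f = act p f + act q f"
  unfolding act_def
  by (rule setsum_keys_plus_distrib) auto

lemma act_uminus [simp]: "act (- p) f = - act p f"
  using act_add[of p "- p" f] by (simp add: eq_neg_iff_add_eq_0 add.commute)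

lemma act_diff [simp]: "act (p - q) f = act p f - act q f"
  using act_add[of p "- q" f] by simp

lemma act_add_right [simp]: "act p (f + g) = act p f + act p g"
  by (simp add: act_def foldr_add sum.distrib)

lemma act_scale_right [simp]: "act p (fscale c f) = fscale c (act p f)"
  by (simp add: act_def foldr_scale fscale_sum mult.commute)

lemma act_0_right [simp]: "act p 0 = 0"
  using act_scale_right[of p 0 0] by simp

lemma act_mult [simp]: "act (p * q) f = act p (act q f)"
  using subset_UNIV
proof (induction p rule: poly_mapping_keys_induct)
  case (single w c)
  show ?case
    using subset_UNIV
    by (induction q rule: poly_mapping_keys_induct)
      (simp_all add: mult_single_list act_single foldr_scale distrib_left mult.commute)
qed (simp_all add: distrib_right)

lemma act_letter [simp]: "act (letter x) f = \<rho> x f"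
  by (simp add: letter_def act_single)

lemma act_fconst [simp]: "act (fconst c) f = fscale c f"
  by (simp add: fconst_def act_single)

lemma act_1 [simp]: "act 1 f = f"
  by (simp flip: fconst_simps(4))

lemma act_power: "act (p ^ n) f = (act p ^^ n) f"
  by (induction n) auto

end

lemma free_algebra_carrier: "p \<in> carrier (free_algebra A) \<longleftrightarrow> Poly_Mapping.keys p \<subseteq> lists A"
  by (simp add: free_algebra_def)

lemma free_algebra_simps [simp]:
  "\<zero>\<^bsub>free_algebra A\<^esub> = 0" "\<one>\<^bsub>free_algebra A\<^esub> = 1"
  "p \<oplus>\<^bsub>free_algebra A\<^esub> q = p + q" "p \<otimes>\<^bsub>free_algebra A\<^esub> q = p * q"
  by (simp_all add: free_algebra_def)

context
  fixes A :: "'x set"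
begin

abbreviation FA :: "('x list \<Rightarrow>\<^sub>0 'k::field) set" where
  "FA \<equiv> carrier (free_algebra A)"

lemma FA_0 [simp]: "0 \<in> FA"
  by (simp add: free_algebra_carrier)

lemma FA_single: "w \<in> lists A \<Longrightarrow> Poly_Mapping.single w c \<in> FA"
  by (simp add: free_algebra_carrier)

lemma FA_fconst [simp]: "fconst c \<in> FA"
  by (simp add: fconst_def FA_single)

lemma FA_letter [simp]: "x \<in> A \<Longrightarrow> letter x \<in> FA"
  by (simp add: letter_def FA_single)

lemma FA_1 [simp]: "1 \<in> FA"
  using FA_fconst[of 1] by (simp add: fconst_simps)

lemma FA_add [simp]: "p \<in> FA \<Longrightarrow> q \<in> FA \<Longrightarrow> p + q \<in> FA"
  using keys_add[of p q] by (auto simp: free_algebra_carrier)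

lemma FA_uminus [simp]: "p \<in> FA \<Longrightarrow> - p \<in> FA"
  by (simp add: free_algebra_carrier)

lemma FA_diff [simp]: "p \<in> FA \<Longrightarrow> q \<in> FA \<Longrightarrow> p - q \<in> FA"
  using FA_add[of p "- q"] by simp

lemma FA_mult [simp]: "p \<in> FA \<Longrightarrow> q \<in> FA \<Longrightarrow> p * q \<in> FA"
  using keys_mult[of p q] by (fastforce simp: free_algebra_carrier plus_list_def)

lemma FA_power [simp]: "p \<in> FA \<Longrightarrow> p ^ n \<in> FA"
  by (induction n) auto

lemma ring_free_algebra: "ring (free_algebra A :: ('x list \<Rightarrow>\<^sub>0 'k::field) ring)"
proof (rule ringI)
  show "abelian_group (free_algebra A :: ('x list \<Rightarrow>\<^sub>0 'k) ring)"
  proof (rule abelian_groupI)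
    fix p :: "'x list \<Rightarrow>\<^sub>0 'k"
    assume "p \<in> FA"
    then have "- p \<in> FA" "- p \<oplus>\<^bsub>free_algebra A\<^esub> p = \<zero>\<^bsub>free_algebra A\<^esub>"
      by simp_all
    then show "\<exists>q\<in>FA. q \<oplus>\<^bsub>free_algebra A\<^esub> p = \<zero>\<^bsub>free_algebra A\<^esub>"
      by blast
  qed (auto simp: algebra_simps)
  show "monoid (free_algebra A :: ('x list \<Rightarrow>\<^sub>0 'k) ring)"
    by (rule monoidI) (auto simp: algebra_simps)
qed (auto simp: algebra_simps)

lemma free_algebra_a_inv: "p \<in> FA \<Longrightarrow> \<ominus>\<^bsub>free_algebra A\<^esub> p = - (p :: 'x list \<Rightarrow>\<^sub>0 'k::field)"
proof -
  interpret ring "free_algebra A :: ('x list \<Rightarrow>\<^sub>0 'k) ring" by (rule ring_free_algebra)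
  show "p \<in> FA \<Longrightarrow> \<ominus>\<^bsub>free_algebra A\<^esub> p = - p"
    by (rule minus_equality) auto
qed

end

text \<open>Constants are central. Instantiating this to letters and words gives terminating rewrite rules
  that collect all constants on the left.\<close>
lemma fconst_pull:
  "p * (fconst c * r) = fconst (c :: 'k::field) * (p * r)"
  by (metis fconst_commute mult.assoc)

lemmas fconst_arith = algebra_simps fconst_simps(2)[symmetric]
  fconst_pull[of "letter x" for x] fconst_commute[of _ "letter x" for x, symmetric]
  fconst_pull[of "letter x ^ k" for x k] fconst_commute[of _ "letter x ^ k" for x k, symmetric]
  fconst_pull[of "Poly_Mapping.single w 1" for w] fconst_commute[of _ "Poly_Mapping.single w 1" for w, symmetric]

lemma fconst_fconst: "fconst a * (fconst b * p) = fconst (a * b :: 'k::field) * p"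
  by (simp add: fconst_simps mult.assoc)

section \<open>Transport of dimension along a linear bijection\<close>

text \<open>The target is only known to be a record with compatible operations, so that the vector space
  axioms are part of what is transported.\<close>

lemma vectorspace_transport:
  fixes V :: "('k, 'v, 'x) module_scheme" and W :: "('k, 'w, 'y) module_scheme"
  assumes V: "vectorspace K V" and bij: "bij_betw \<phi> (carrier V) (carrier W)"
    and zero: "\<phi> \<zero>\<^bsub>V\<^esub> = \<zero>\<^bsub>W\<^esub>"
    and add: "\<And>u v. u \<in> carrier V \<Longrightarrow> v \<in> carrier V \<Longrightarrow> \<phi> (u \<oplus>\<^bsub>V\<^esub> v) = \<phi> u \<oplus>\<^bsub>W\<^esub> \<phi> v"
    and smult: "\<And>c v. c \<in> carrier K \<Longrightarrow> v \<in> carrier V \<Longrightarrow> \<phi> (c \<odot>\<^bsub>V\<^esub> v) = c \<odot>\<^bsub>W\<^esub> \<phi> v"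
    and fin: "vectorspace.fin_dim K V"
  shows "vectorspace K W" "vectorspace.fin_dim K W" "vectorspace.dim K W = vectorspace.dim K V"
proof -
  interpret V: vectorspace K V by (rule V)
  have W_eq: "carrier W = \<phi> ` carrier V"
    using bij by (simp add: bij_betw_def)
  have [simp]: "\<phi> u \<in> carrier W" if "u \<in> carrier V" for u
    using that by (simp add: W_eq)
  note rev = add[symmetric] smult[symmetric] zero[symmetric]
  have "abelian_group W"
  proof (rule abelian_groupI)
    show "\<exists>y\<in>carrier W. y \<oplus>\<^bsub>W\<^esub> x = \<zero>\<^bsub>W\<^esub>" if "x \<in> carrier W" for x
    proof -
      obtain v where v: "v \<in> carrier V" "x = \<phi> v"
        using \<open>x \<in> carrier W\<close> W_eq by auto
      then have "\<phi> (\<ominus>\<^bsub>V\<^esub> v) \<oplus>\<^bsub>W\<^esub> x = \<zero>\<^bsub>W\<^esub>"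
        by (simp add: rev V.M.l_neg)
      then show ?thesis
        using v(1) by (intro bexI[of _ "\<phi> (\<ominus>\<^bsub>V\<^esub> v)"]) auto
    qed
  qed (auto simp: W_eq rev V.M.a_assoc intro!: V.M.a_comm arg_cong[of _ _ \<phi>])
  then have "module K W"
    by (intro Module.moduleI)
      (auto simp: W_eq rev V.smult_l_distr V.smult_r_distr V.smult_assoc1 intro: V.R.is_cring)
  then show W: "vectorspace K W"
    by (intro vectorspace.intro V.field_axioms)
  interpret W: vectorspace K W by (rule W)
  interpret T: linear_map K V W \<phi>
    by unfold_locales (auto simp: module_hom_def add smult)
  show "vectorspace.fin_dim K W"
    by (rule T.image_fin_dim) (use fin W_eq in auto)
  show "vectorspace.dim K W = vectorspace.dim K V"
    by (rule T.dim_eq[symmetric]) (use fin bij in \<open>auto simp: bij_betw_def\<close>)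
qed

section \<open>Quotients by kernels of additive maps\<close>

text \<open>The cosets of the kernel are the fibres. Describing the quotient by fibres makes its operations
  those of the image, without any choice of representatives.\<close>

locale additive_map = abelian_group M for M :: "('r, 'a, 't) module_scheme" (structure) +
  fixes \<theta> :: "'a \<Rightarrow> 'w::ab_group_add"
  assumes \<theta>_add: "u \<in> carrier M \<Longrightarrow> v \<in> carrier M \<Longrightarrow> \<theta> (u \<oplus> v) = \<theta> u + \<theta> v"
begin

definition fibre :: "'w \<Rightarrow> 'a set" where
  "fibre w = {v \<in> carrier M. \<theta> v = w}"

lemma \<theta>_zero: "\<theta> \<zero> = 0"
  using \<theta>_add[of \<zero> \<zero>] by simp

lemma \<theta>_minus: "v \<in> carrier M \<Longrightarrow> \<theta> (\<ominus> v) = - \<theta> v"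
  using \<theta>_add[of v "\<ominus> v"] by (simp add: r_neg \<theta>_zero eq_neg_iff_add_eq_0 add.commute)

lemma coset_eq_fibre:
  assumes "v \<in> carrier M"
  shows "fibre 0 +> v = fibre (\<theta> v)"
proof -
  have "u \<in> fibre 0 +> v" if "u \<in> fibre (\<theta> v)" for u
  proof -
    have "u \<ominus> v \<in> fibre 0" "u = (u \<ominus> v) \<oplus> v"
      using that assms by (auto simp: fibre_def a_minus_def \<theta>_add \<theta>_minus a_assoc l_neg)
    then show ?thesis
      unfolding a_r_coset_def r_coset_def by auto
  qed
  then show ?thesis
    using assms by (auto simp: a_r_coset_def r_coset_def fibre_def \<theta>_add)
qed

lemma carrier_quotient: "carrier (quotient_module M (fibre 0)) = (\<lambda>v. fibre (\<theta> v)) ` carrier M"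
  by (auto simp: quotient_module_def A_RCOSETS_def RCOSETS_def coset_eq_fibre
      simp flip: a_r_coset_def)

lemma fibre_add:
  assumes "u \<in> carrier M" "v \<in> carrier M"
  shows "fibre (\<theta> u) \<oplus>\<^bsub>quotient_module M (fibre 0)\<^esub> fibre (\<theta> v) = fibre (\<theta> u + \<theta> v)"
proof -
  have "w \<in> set_add M (fibre (\<theta> u)) (fibre (\<theta> v))" if "w \<in> fibre (\<theta> u + \<theta> v)" for w
  proof -
    have "w \<ominus> v \<in> fibre (\<theta> u)" "w = (w \<ominus> v) \<oplus> v" "v \<in> fibre (\<theta> v)"
      using that assms by (auto simp: fibre_def a_minus_def \<theta>_add \<theta>_minus a_assoc l_neg)
    then show ?thesis
      unfolding set_add_def set_mult_def by auto
  qed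
  then show ?thesis
    by (auto simp: quotient_module_def set_add_def set_mult_def fibre_def \<theta>_add)
qed

lemma fibre_smult:
  assumes v: "v \<in> carrier M"
    and closed: "\<And>u. u \<in> carrier M \<Longrightarrow> r \<odot> u \<in> carrier M"
    and comp: "\<And>u. u \<in> carrier M \<Longrightarrow> \<theta> (r \<odot> u) = a (\<theta> u)"
  shows "r \<odot>\<^bsub>quotient_module M (fibre 0)\<^esub> fibre (\<theta> v) = fibre (a (\<theta> v))"
proof -
  have "fibre 0 +> r \<odot> u = fibre (a (\<theta> v))" if "u \<in> fibre (\<theta> v)" for u
    using that closed comp by (auto simp: fibre_def coset_eq_fibre[unfolded fibre_def])
  moreover have "v \<in> fibre (\<theta> v)"
    using v by (simp add: fibre_def)
  ultimately show ?thesis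
    unfolding quotient_module_def by auto
qed

end

section \<open>Induced modules\<close>

text \<open>The calculus of pure tensors in \<open>R \<otimes>\<^sub>S N\<close>, where \<open>S\<close> acts on \<open>R\<close> from the right and on \<open>N\<close> from the
  left.\<close>

locale induction_datum = ring R for R :: "('r, 's) ring_scheme" (structure) +
  fixes S :: "'r set" and N :: "('r, 'v, 't) module_scheme"
  assumes S_sub: "S \<subseteq> carrier R"
    and N_add: "\<And>v v'. v \<in> carrier N \<Longrightarrow> v' \<in> carrier N \<Longrightarrow> v \<oplus>\<^bsub>N\<^esub> v' \<in> carrier N"
    and N_smult: "\<And>s v. s \<in> S \<Longrightarrow> v \<in> carrier N \<Longrightarrow> s \<odot>\<^bsub>N\<^esub> v \<in> carrier N"
begin

abbreviation F :: "('r \<times> 'v \<Rightarrow>\<^sub>0 int) monoid" where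
  "F \<equiv> free_Abelian_group (carrier R \<times> carrier N)"

abbreviation T :: "('r \<times> 'v \<Rightarrow>\<^sub>0 int) set" where
  "T \<equiv> generate F (tensor_relations R S N)"

abbreviation Z :: "('r, ('r \<times> 'v \<Rightarrow>\<^sub>0 int) set) module" where
  "Z \<equiv> induced_module R S N"

definition pure :: "'r \<Rightarrow> 'v \<Rightarrow> ('r \<times> 'v \<Rightarrow>\<^sub>0 int) set" where
  "pure r v = T #>\<^bsub>F\<^esub> frag_of (r, v)"

interpretation F: comm_group F
  by (rule abelian_free_Abelian_group)

lemma relations_carrier: "tensor_relations R S N \<subseteq> carrier F"
proof -
  have "frag_of a - frag_of b - frag_of c \<in> carrier F" "frag_of a - frag_of b \<in> carrier F"
    if "a \<in> carrier R \<times> carrier N" "b \<in> carrier R \<times> carrier N" "c \<in> carrier R \<times> carrier N" for a b c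
    using that
    by (auto dest!: subsetD[OF keys_diff])
  then show ?thesis
    using S_sub N_add N_smult unfolding tensor_relations_def
    by (auto simp del: carrier_free_Abelian_group_iff)
qed

interpretation T: normal T F
proof -
  have "subgroup T F"
    by (rule F.generate_is_subgroup[OF relations_carrier])
  then show "T \<lhd> F"
    by (simp add: F.normal_iff_subgroup)
qed

lemma Z_simps:
  "carrier Z = carrier (F Mod T)" "add Z = mult (F Mod T)" "\<zero>\<^bsub>Z\<^esub> = T"
  "r \<odot>\<^bsub>Z\<^esub> C = (\<Union>f\<in>C. T #>\<^bsub>F\<^esub> frag_extend (\<lambda>(r', v). frag_of (r \<otimes> r', v)) f)"
  by (simp_all add: induced_module_def Let_def FactGroup_def)

lemma abelian_group_induced: "abelian_group Z"
proof -
  interpret Q: comm_group "F Mod T"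
    by (rule F.abelian_FactGroup) (rule T.subgroup_axioms)
  have one: "\<one>\<^bsub>F Mod T\<^esub> = T"
    by (simp add: FactGroup_def)
  show ?thesis
  proof (rule abelian_groupI)
    show "\<exists>y\<in>carrier Z. y \<oplus>\<^bsub>Z\<^esub> x = \<zero>\<^bsub>Z\<^esub>" if "x \<in> carrier Z" for x
      using Q.inv_closed[of x] Q.l_inv[of x] that unfolding Z_simps one by blast
  qed (use Q.m_closed Q.m_assoc Q.m_comm Q.l_one Q.one_closed in \<open>auto simp: Z_simps one\<close>)
qed

lemma coset_eqI:
  assumes "a \<in> carrier F" "b \<in> carrier F" "a - b \<in> T"
  shows "T #>\<^bsub>F\<^esub> a = T #>\<^bsub>F\<^esub> b"
proof -
  have "a = (a - b) \<otimes>\<^bsub>F\<^esub> b" by simp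
  then have "a \<in> T #>\<^bsub>F\<^esub> b"
    using assms(3) unfolding r_coset_def by blast
  then show ?thesis
    using F.repr_independence[OF _ assms(2) T.subgroup_axioms] by simp
qed

lemma coset_add:
  assumes "a \<in> carrier F" "b \<in> carrier F"
  shows "(T #>\<^bsub>F\<^esub> a) \<oplus>\<^bsub>Z\<^esub> (T #>\<^bsub>F\<^esub> b) = T #>\<^bsub>F\<^esub> (a + b)"
  using T.rcos_sum[OF assms] by (simp add: Z_simps FactGroup_def)

lemma F_add: "a \<in> carrier F \<Longrightarrow> b \<in> carrier F \<Longrightarrow> a + b \<in> carrier F"
  using F.m_closed[of a b] by simp

lemma F_diff: "a \<in> carrier F \<Longrightarrow> b \<in> carrier F \<Longrightarrow> a - b \<in> carrier F"
  by (auto dest: subsetD[OF keys_diff])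

lemma coset_mem: "a \<in> carrier F \<Longrightarrow> T #>\<^bsub>F\<^esub> a \<in> carrier Z"
  by (auto simp: Z_simps carrier_FactGroup)

lemma pure_closed [simp]: "r \<in> carrier R \<Longrightarrow> v \<in> carrier N \<Longrightarrow> pure r v \<in> carrier Z"
  by (auto simp: pure_def intro!: coset_mem)

lemma pure_add_left:
  assumes "r \<in> carrier R" "r' \<in> carrier R" "v \<in> carrier N"
  shows "pure (r \<oplus> r') v = pure r v \<oplus>\<^bsub>Z\<^esub> pure r' v"
proof -
  have "frag_of (r \<oplus> r', v) - frag_of (r, v) - frag_of (r', v) \<in> T"
    using assms unfolding tensor_relations_def by (intro generate.incl) blast
  then have "frag_of (r \<oplus> r', v) - (frag_of (r, v) + frag_of (r', v)) \<in> T"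
    by (simp add: diff_diff_eq)
  then show ?thesis
    using assms unfolding pure_def
    by (subst coset_add) (simp_all add: coset_eqI F_add del: carrier_free_Abelian_group_iff)
qed

lemma pure_balanced:
  assumes "r \<in> carrier R" "s \<in> S" "v \<in> carrier N"
  shows "pure (r \<otimes> s) v = pure r (s \<odot>\<^bsub>N\<^esub> v)"
proof -
  have "frag_of (r \<otimes> s, v) - frag_of (r, s \<odot>\<^bsub>N\<^esub> v) \<in> T"
    using assms unfolding tensor_relations_def by (intro generate.incl) blast
  then show ?thesis
    using assms S_sub N_smult unfolding pure_def
    by (intro coset_eqI) auto
qed

text \<open>Every element of the tensor product is a sum of pure tensors and their negatives.\<close>
lemma induced_induct [consumes 1, case_names pure add minus zero]:
  assumes "z \<in> carrier Z"
    and "\<And>r v. r \<in> carrier R \<Longrightarrow> v \<in> carrier N \<Longrightarrow> P (pure r v)"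
    and "\<And>z z'. z \<in> carrier Z \<Longrightarrow> z' \<in> carrier Z \<Longrightarrow> P z \<Longrightarrow> P z' \<Longrightarrow> P (z \<oplus>\<^bsub>Z\<^esub> z')"
    and "\<And>z. z \<in> carrier Z \<Longrightarrow> P z \<Longrightarrow> P (\<ominus>\<^bsub>Z\<^esub> z)"
    and "P \<zero>\<^bsub>Z\<^esub>"
  shows "P z"
proof -
  interpret Z: abelian_group Z by (rule abelian_group_induced)
  have *: "T #>\<^bsub>F\<^esub> (a - b) = (T #>\<^bsub>F\<^esub> a) \<oplus>\<^bsub>Z\<^esub> \<ominus>\<^bsub>Z\<^esub> (T #>\<^bsub>F\<^esub> b)"
    if "a \<in> carrier F" "b \<in> carrier F" for a b
  proof -
    note ab = F_diff[OF that]
    have "(T #>\<^bsub>F\<^esub> (a - b)) \<oplus>\<^bsub>Z\<^esub> (T #>\<^bsub>F\<^esub> b) = T #>\<^bsub>F\<^esub> a"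
      using coset_add[OF ab that(2)] by simp
    then show ?thesis
      using coset_mem[OF ab] coset_mem[OF that(1)] coset_mem[OF that(2)]
      by (metis Z.minus_eq Z.a_assoc Z.r_neg Z.r_zero Z.a_inv_closed)
  qed
  have "P (T #>\<^bsub>F\<^esub> f)" if "f \<in> carrier F" for f
  proof (rule free_Abelian_group_induct[OF that[unfolded carrier_free_Abelian_group_iff]])
    have "T #>\<^bsub>F\<^esub> 0 = T"
      using F.coset_join2[OF _ T.subgroup_axioms, of 0] T.one_closed by simp
    then show "P (T #>\<^bsub>F\<^esub> 0)"
      using assms(5) by (simp add: Z_simps)
    show "P (T #>\<^bsub>F\<^esub> (a - b))" if "Poly_Mapping.keys a \<subseteq> carrier R \<times> carrier N"
      "Poly_Mapping.keys b \<subseteq> carrier R \<times> carrier N" "P (T #>\<^bsub>F\<^esub> a)" "P (T #>\<^bsub>F\<^esub> b)" for a b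
      using that assms(3,4) coset_mem[of a] coset_mem[of b] by (simp add: *)
    show "P (T #>\<^bsub>F\<^esub> frag_of a)" if "a \<in> carrier R \<times> carrier N" for a
      using that assms(2) by (auto simp: pure_def)
  qed
  then show ?thesis
    using assms(1) by (auto simp: Z_simps carrier_FactGroup)
qed

text \<open>The union in the definition of scalar multiplication is a single coset: left multiplication on the
  first tensor factor maps each of the three kinds of relations to a relation of the same kind.\<close>
lemma smult_coset:
  assumes "r \<in> carrier R" "f \<in> carrier F"
  shows "r \<odot>\<^bsub>Z\<^esub> (T #>\<^bsub>F\<^esub> f) = T #>\<^bsub>F\<^esub> frag_extend (\<lambda>(r', v). frag_of (r \<otimes> r', v)) f"
proof -
  let ?e = "frag_extend (\<lambda>(r', v). frag_of (r \<otimes> r', v)) :: ('r \<times> 'v \<Rightarrow>\<^sub>0 int) \<Rightarrow> _"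
  have e_F: "?e f \<in> carrier F" if "f \<in> carrier F" for f
    using that keys_frag_extend[of "\<lambda>(r', v). frag_of (r \<otimes> r', v)" f] assms(1)
    by (fastforce simp: split_beta)
  have e_T: "?e t \<in> T" if "t \<in> T" for t
    using that
  proof (induction t rule: generate.induct)
    case one
    show ?case using T.one_closed by simp
  next
    have rel: "?e h \<in> tensor_relations R S N" if h: "h \<in> tensor_relations R S N" for h
    proof -
      consider (l) r1 r2 v where "h = frag_of (r1 \<oplus> r2, v) - frag_of (r1, v) - frag_of (r2, v)"
          "r1 \<in> carrier R" "r2 \<in> carrier R" "v \<in> carrier N"
        | (r) r1 v v' where "h = frag_of (r1, v \<oplus>\<^bsub>N\<^esub> v') - frag_of (r1, v) - frag_of (r1, v')"
          "r1 \<in> carrier R" "v \<in> carrier N" "v' \<in> carrier N"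
        | (b) r1 s v where "h = frag_of (r1 \<otimes> s, v) - frag_of (r1, s \<odot>\<^bsub>N\<^esub> v)"
          "r1 \<in> carrier R" "s \<in> S" "v \<in> carrier N"
        using h unfolding tensor_relations_def by blast
      then show ?thesis
      proof cases
        case l
        then have "?e h = frag_of (r \<otimes> r1 \<oplus> r \<otimes> r2, v) - frag_of (r \<otimes> r1, v) - frag_of (r \<otimes> r2, v)"
          using assms(1) by (simp add: frag_extend_diff r_distr)
        then show ?thesis
          using l assms(1) unfolding tensor_relations_def by (blast intro: m_closed)
      next
        case r
        then have "?e h = frag_of (r \<otimes> r1, v \<oplus>\<^bsub>N\<^esub> v') - frag_of (r \<otimes> r1, v) - frag_of (r \<otimes> r1, v')"
          by (simp add: frag_extend_diff)
        then show ?thesis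
          using r assms(1) unfolding tensor_relations_def by (blast intro: m_closed)
      next
        case b
        then have "?e h = frag_of ((r \<otimes> r1) \<otimes> s, v) - frag_of (r \<otimes> r1, s \<odot>\<^bsub>N\<^esub> v)"
          using assms(1) S_sub by (auto simp add: frag_extend_diff m_assoc)
        then show ?thesis
          using b assms(1) unfolding tensor_relations_def by (blast intro: m_closed)
      qed
    qed
    { case (incl h)
      then show ?case by (rule generate.incl[OF rel])
    next
      case (inv h)
      have "h \<in> carrier F" "?e h \<in> carrier F"
        by (rule subsetD[OF relations_carrier inv]) (rule subsetD[OF relations_carrier rel[OF inv]])
      then have "?e (inv\<^bsub>F\<^esub> h) = inv\<^bsub>F\<^esub> (?e h)"
        by (simp add: frag_extend_minus)
      then show ?case
        using generate.inv[OF rel[OF inv]] by simp }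
  next
    case (eng h1 h2)
    then show ?case
      using T.m_closed[of "?e h1" "?e h2"] by (simp add: frag_extend_add)
  qed
  have "T #>\<^bsub>F\<^esub> ?e g = T #>\<^bsub>F\<^esub> ?e f" if g: "g \<in> T #>\<^bsub>F\<^esub> f" for g
  proof -
    obtain t where t: "t \<in> T" "g = t + f"
      using g unfolding r_coset_def by auto
    have "?e g - ?e f \<in> T"
      using e_T[OF t(1)] by (simp add: t(2) frag_extend_add)
    moreover have "g \<in> carrier F"
      using that T.subset assms(2) F.r_coset_subset_G by blast
    ultimately show ?thesis
      by (intro coset_eqI e_F assms)
  qed
  moreover have "f \<in> T #>\<^bsub>F\<^esub> f"
    by (rule F.rcos_self[OF assms(2) T.subgroup_axioms])
  ultimately show ?thesis
    unfolding Z_simps by blast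
qed

lemma smult_pure: "r \<in> carrier R \<Longrightarrow> r' \<in> carrier R \<Longrightarrow> v \<in> carrier N \<Longrightarrow>
    r \<odot>\<^bsub>Z\<^esub> pure r' v = pure (r \<otimes> r') v"
  by (auto simp: pure_def smult_coset)

text \<open>The universal property of the tensor product: the additive extension of a biadditive balanced map
  to the free abelian group kills the relations.\<close>
lemma induced_lift:
  fixes b :: "'r \<Rightarrow> 'v \<Rightarrow> 'w::ab_group_add"
  assumes b1: "\<And>r r' v. r \<in> carrier R \<Longrightarrow> r' \<in> carrier R \<Longrightarrow> v \<in> carrier N \<Longrightarrow> b (r \<oplus> r') v = b r v + b r' v"
    and b2: "\<And>r v v'. r \<in> carrier R \<Longrightarrow> v \<in> carrier N \<Longrightarrow> v' \<in> carrier N \<Longrightarrow> b r (v \<oplus>\<^bsub>N\<^esub> v') = b r v + b r v'"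
    and b3: "\<And>r s v. r \<in> carrier R \<Longrightarrow> s \<in> S \<Longrightarrow> v \<in> carrier N \<Longrightarrow> b (r \<otimes> s) v = b r (s \<odot>\<^bsub>N\<^esub> v)"
  obtains \<theta> where "additive_map Z \<theta>"
    "\<And>r v. r \<in> carrier R \<Longrightarrow> v \<in> carrier N \<Longrightarrow> \<theta> (pure r v) = b r v"
proof -
  \<comment> \<open>The universal property of free abelian groups is stated for group records, so the additive group of the target is turned into one.\<close>
  let ?W = "\<lparr>carrier = UNIV, monoid.mult = (+), one = (0::'w)\<rparr>"
  interpret W: comm_group ?W
    by (rule comm_groupI) (auto simp: algebra_simps intro: exI[of _ "- _"] left_minus)
  obtain h where h: "h \<in> hom F ?W" "\<And>x. x \<in> carrier R \<times> carrier N \<Longrightarrow> h (frag_of x) = case_prod b x"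
    by (rule W.free_Abelian_group_universal[of "case_prod b" "carrier R \<times> carrier N"]) auto
  interpret h: group_hom F ?W h
    using h(1) by (simp add: group_hom_def group_hom_axioms_def F.is_group W.is_group)
  have h_add: "h (x + y) = h x + h y" if "x \<in> carrier F" "y \<in> carrier F" for x y
    using h.hom_mult[OF that] by simp
  have h_diff: "h (x - y) = h x - h y" if "x \<in> carrier F" "y \<in> carrier F" for x y
    using h_add[OF F_diff[OF that] that(2)] by simp
  have "tensor_relations R S N \<subseteq> kernel F ?W h"
  proof
    fix t assume t: "t \<in> tensor_relations R S N"
    have "h t = 0"
      using t unfolding tensor_relations_def
      by (elim UnE CollectE exE conjE)
        (simp_all only: h_diff F_diff frag_of_in_free_Abelian_group h(2) mem_Sigma_iff a_closed m_closed
          N_add N_smult subsetD[OF S_sub] case_prod_conv b1 b2 b3 simp_thms, simp_all)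
    then show "t \<in> kernel F ?W h"
      using subsetD[OF relations_carrier t] unfolding kernel_def by simp
  qed
  then have T_ker: "T \<subseteq> kernel F ?W h"
    by (rule F.generate_subgroup_incl) (rule h.subgroup_kernel)
  define \<theta> where "\<theta> C = h (SOME f. f \<in> C)" for C
  have \<theta>: "\<theta> (T #>\<^bsub>F\<^esub> f) = h f" if "f \<in> carrier F" for f
  proof -
    have "(SOME g. g \<in> T #>\<^bsub>F\<^esub> f) \<in> T #>\<^bsub>F\<^esub> f"
      using F.rcos_self[OF that T.subgroup_axioms] by (rule someI)
    then obtain t where t: "t \<in> T" "(SOME g. g \<in> T #>\<^bsub>F\<^esub> f) = t + f"
      unfolding r_coset_def by auto
    then have "h t = 0" "t \<in> carrier F"
      using T_ker by (auto simp: kernel_def)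
    then show ?thesis
      using t(2) h_add[OF _ that] by (simp add: \<theta>_def)
  qed
  show ?thesis
  proof
    interpret Z: abelian_group Z by (rule abelian_group_induced)
    show "additive_map Z \<theta>"
    proof
      fix u v assume "u \<in> carrier Z" "v \<in> carrier Z"
      then obtain a b where ab: "a \<in> carrier F" "b \<in> carrier F" "u = T #>\<^bsub>F\<^esub> a" "v = T #>\<^bsub>F\<^esub> b"
        by (auto simp: Z_simps carrier_FactGroup)
      moreover have "a + b \<in> carrier F"
        using F.m_closed[OF ab(1,2)] by simp
      ultimately show "\<theta> (u \<oplus>\<^bsub>Z\<^esub> v) = \<theta> u + \<theta> v"
        by (simp only: coset_add \<theta> h_add)
    qed
    show "\<theta> (pure r v) = b r v" if "r \<in> carrier R" "v \<in> carrier N" for r v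
      using that by (simp add: pure_def \<theta> h(2))
  qed
qed

end

section \<open>The datum and its commutation factors\<close>

locale linked_datum =
  fixes D :: "('g, 'k::field) datum" and \<gamma> :: "'g \<Rightarrow> 'k"
  assumes datum: "simply_linked_datum D" and \<gamma>: "\<gamma> \<in> characters (grp D)"
begin

abbreviation "G \<equiv> grp D"
definition "I = {1..rnk D}"
abbreviation "q \<equiv> qm D"
abbreviation "m \<equiv> mord D"
abbreviation "\<chi> \<equiv> chr D"

lemma finite_I [simp]: "finite I"
  by (simp add: I_def)

lemma I_down: "i \<in> I \<Longrightarrow> j \<in> {1..<i} \<Longrightarrow> j \<in> I"
  by (simp add: I_def)

lemma I_pos: "i \<in> I \<Longrightarrow> 1 \<le> i"
  by (simp add: I_def)

definition ab :: "nat \<Rightarrow> 'g" where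
  "ab i = elA D i \<otimes>\<^bsub>G\<^esub> elB D i"

lemma group_G: "comm_group G"
  using datum by (simp add: simply_linked_datum_def)

sublocale G: comm_group G
  by (rule group_G)

lemma elA [simp]: "i \<in> I \<Longrightarrow> elA D i \<in> carrier G" and elB [simp]: "i \<in> I \<Longrightarrow> elB D i \<in> carrier G"
  and \<chi>: "i \<in> I \<Longrightarrow> \<chi> i \<in> characters G" and m_ge: "i \<in> I \<Longrightarrow> m i \<ge> 2"
  using datum by (simp_all add: simply_linked_datum_def I_def)

lemma ab_closed [simp]: "i \<in> I \<Longrightarrow> ab i \<in> carrier G"
  by (simp add: ab_def)

lemma character_mult:
  "c \<in> characters G \<Longrightarrow> h \<in> carrier G \<Longrightarrow> h' \<in> carrier G \<Longrightarrow> c (h \<otimes>\<^bsub>G\<^esub> h') = c h * (c h' :: 'k)"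
  by (simp add: characters_def hom_def units_of_def)

lemma character_nonzero: "c \<in> characters G \<Longrightarrow> h \<in> carrier G \<Longrightarrow> c h \<noteq> (0 :: 'k)"
  by (auto simp: characters_def hom_def units_of_def Units_def Pi_def)

lemma character_one: "c \<in> characters G \<Longrightarrow> c \<one>\<^bsub>G\<^esub> = (1 :: 'k)"
  using character_mult[of c "\<one>\<^bsub>G\<^esub>" "\<one>\<^bsub>G\<^esub>"] character_nonzero[of c "\<one>\<^bsub>G\<^esub>"] by simp

lemma q_nonzero: "i \<in> I \<Longrightarrow> j \<in> I \<Longrightarrow> q i j \<noteq> 0"
  by (simp add: qm_def character_nonzero[OF \<chi>])

lemma q_sym: "i \<in> I \<Longrightarrow> j \<in> I \<Longrightarrow> i \<noteq> j \<Longrightarrow> q j i * q i j = 1"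
  using datum unfolding simply_linked_datum_def qm_def I_def by blast

lemma q_inverse: "i \<in> I \<Longrightarrow> j \<in> I \<Longrightarrow> i \<noteq> j \<Longrightarrow> inverse (q i j) = q j i"
  using q_sym[of i j] q_nonzero[of i j] by (simp add: field_simps)

text \<open>By the linking condition the character value is \<open>q\<^sub>i\<^sub>j q\<^sub>j\<^sub>i\<close>. This is why \<open>a\<^sub>i b\<^sub>i\<close> commutes with
  \<open>x\<^sub>j\<close> for \<open>j \<noteq> i\<close>, and why the rank one computations for different \<open>i\<close> do not interact.\<close>
lemma \<chi>_ab: "i \<in> I \<Longrightarrow> j \<in> I \<Longrightarrow> \<chi> j (ab i) = (if i = j then (q i i)\<^sup>2 else 1)"
proof -
  assume ij: "i \<in> I" "j \<in> I"
  then have "\<chi> i (elA D j) = \<chi> j (elB D i)"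
    using datum unfolding simply_linked_datum_def I_def by blast
  then have "\<chi> j (ab i) = q i j * q j i"
    using ij by (simp add: ab_def character_mult[OF \<chi>] qm_def)
  then show ?thesis
    using q_sym[of i j] ij by (auto simp: power2_eq_square mult.commute)
qed

lemma q_power_eq_1:
  assumes "i \<in> I"
  shows "q i i ^ s = 1 \<longleftrightarrow> m i dvd s"
proof -
  interpret U: group "units_of (class_ring :: 'k ring)"
    by (rule monoid.units_group[OF ring.is_monoid[OF class_ring.ring_axioms]])
  have pow: "x [^]\<^bsub>units_of (class_ring :: 'k ring)\<^esub> s = x ^ s" for x :: 'k
    by (induction s) (simp_all add: units_of_def mult.commute)
  have "q i i \<in> carrier (units_of (class_ring :: 'k ring))"
    using q_nonzero[OF assms assms] by (auto simp: units_of_def Units_def intro!: exI[of _ "inverse (q i i)"])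
  then show ?thesis
    using U.pow_eq_id[of "q i i" s] unfolding mord_def pow by (simp add: units_of_def)
qed

lemma q_neq_1: "i \<in> I \<Longrightarrow> q i i \<noteq> 1"
  using q_power_eq_1[of i 1] m_ge[of i] by auto

lemma q_power_inj: "i \<in> I \<Longrightarrow> q i i ^ s = q i i ^ t \<Longrightarrow> s < m i \<Longrightarrow> t < m i \<Longrightarrow> s = t"
proof (induction s t rule: linorder_wlog)
  case (le s t)
  then have "q i i ^ (t - s) = 1"
    using q_nonzero[of i i] by (simp add: power_diff)
  then have "m i dvd t - s"
    using le by (simp add: q_power_eq_1)
  then show ?case
    using le nat_dvd_not_less[of "t - s" "m i"] by force
qed simp

lemma is_exponent_iff:
  "i \<in> I \<Longrightarrow> is_exponent D \<gamma> i e \<longleftrightarrow> e + 2 \<le> m i \<and> \<gamma> (ab i) * q i i ^ e = 1"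
  using q_nonzero[of i i]
  by (auto simp: is_exponent_def ab_def power_int_minus field_simps)

text \<open>The exponent is unique because the powers \<open>q\<^sub>i\<^sup>e\<close> with \<open>e < m\<^sub>i\<close> are distinct.\<close>
lemma e_exp: "i \<in> S_set D \<gamma> \<Longrightarrow> is_exponent D \<gamma> i (e_exp D \<gamma> i)"
proof -
  assume "i \<in> S_set D \<gamma>"
  then obtain e where i: "i \<in> I" and e: "is_exponent D \<gamma> i e"
    by (auto simp: S_set_def I_def)
  have "e' = e" if "is_exponent D \<gamma> i e'" for e'
  proof (rule q_power_inj[OF i])
    have "\<gamma> (ab i) \<noteq> 0"
      using character_nonzero[OF \<gamma>] i by simp
    then show "q i i ^ e' = q i i ^ e"
      using e that i by (simp add: is_exponent_iff) (metis mult_left_cancel)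
  qed (use e that i in \<open>auto simp: is_exponent_iff\<close>)
  then show ?thesis
    unfolding e_exp_def using e by (rule theI[rotated])
qed

section \<open>The coefficients of the lowering operators\<close>

text \<open>The side lengths of the box of exponents that indexes the basis of the simple module.\<close>

definition bound :: "nat \<Rightarrow> nat" where
  "bound i = (if i \<in> S_set D \<gamma> then e_exp D \<gamma> i + 1 else m i)"

lemma bound_le: "i \<in> I \<Longrightarrow> bound i \<le> m i"
  using e_exp[of i] by (auto simp: bound_def is_exponent_iff)

lemma bound_pos: "i \<in> I \<Longrightarrow> 0 < bound i"
  using m_ge[of i] by (auto simp: bound_def)

text \<open>The coefficient with which \<open>y\<^sub>i\<close> maps \<open>x\<^sub>i\<^sup>s v\<close> to \<open>x\<^sub>i\<^sup>s\<^sup>-\<^sup>1 v\<close>, for a highest weight vector \<open>v\<close>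
  of weight \<open>\<gamma>\<close>.\<close>
definition ycoef :: "nat \<Rightarrow> nat \<Rightarrow> 'k" where
  "ycoef i s = (\<Sum>t<s. q i i ^ t) * (q i i - \<gamma> (ab i) * q i i ^ s)"

text \<open>This recursion is the relation \<open>x\<^sub>i y\<^sub>i - q\<^sub>i\<^sup>-\<^sup>1 y\<^sub>i x\<^sub>i = a\<^sub>i b\<^sub>i - 1\<close> applied to \<open>x\<^sub>i\<^sup>s v\<close>.\<close>
lemma ycoef_step:
  assumes "i \<in> I"
  shows "ycoef i s - inverse (q i i) * ycoef i (Suc s) = \<gamma> (ab i) * (q i i)\<^sup>2 ^ s - 1"
proof -
  define S where "S = (\<Sum>t<s. q i i ^ t)"
  \<comment> \<open>the geometric sum of length \<open>s + 1\<close>, split off at its first and at its last term\<close>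
  have *: "1 + q i i * S = S + q i i ^ s"
    unfolding S_def using sum.lessThan_Suc_shift[of "\<lambda>t. q i i ^ t" s]
    by (simp add: sum_distrib_left)
  have 1: "inverse (q i i) * ycoef i (Suc s) = (S + q i i ^ s) * (1 - \<gamma> (ab i) * q i i ^ s)"
    using q_nonzero[OF assms assms] by (simp add: ycoef_def S_def field_simps)
  have 2: "ycoef i s = S * (q i i - \<gamma> (ab i) * q i i ^ s)"
    by (simp add: ycoef_def S_def)
  have 3: "(q i i)\<^sup>2 ^ s = q i i ^ s * q i i ^ s"
    by (simp add: power2_eq_square power_mult_distrib)
  have "ycoef i s - inverse (q i i) * ycoef i (Suc s) =
      (1 + q i i * S) - (S + q i i ^ s) + (\<gamma> (ab i) * (q i i)\<^sup>2 ^ s - 1)"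
    unfolding 1 2 3 by (simp add: algebra_simps)
  then show ?thesis
    by (simp add: *)
qed

lemma ycoef_0 [simp]: "ycoef i 0 = 0"
  by (simp add: ycoef_def)

lemma geometric_zero_iff: "i \<in> I \<Longrightarrow> (\<Sum>t<s. q i i ^ t) = 0 \<longleftrightarrow> m i dvd s"
  using q_neq_1[of i] q_power_eq_1[of i s] by (simp add: geometric_sum)

lemma ycoef_Suc_zero_iff:
  "i \<in> I \<Longrightarrow> ycoef i (Suc s) = 0 \<longleftrightarrow> m i dvd Suc s \<or> \<gamma> (ab i) * q i i ^ s = 1"
  using q_nonzero[of i i] by (auto simp: ycoef_def geometric_zero_iff simp del: sum.lessThan_Suc)

text \<open>With the next lemma, \<open>bound i\<close> is the first positive zero: the \<open>x\<^sub>i\<close>-string may be cut off there,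
  and nowhere earlier.\<close>
lemma ycoef_bound [simp]: "i \<in> I \<Longrightarrow> ycoef i (bound i) = 0"
proof (cases "i \<in> S_set D \<gamma>")
  case True
  assume "i \<in> I"
  then show ?thesis
    using True e_exp[OF True] by (simp add: bound_def is_exponent_iff ycoef_Suc_zero_iff)
next
  case False
  assume "i \<in> I"
  then show ?thesis
    using False by (simp add: bound_def ycoef_def geometric_zero_iff)
qed

lemma ycoef_nonzero:
  assumes i: "i \<in> I" and s: "0 < s" "s < bound i"
  shows "ycoef i s \<noteq> 0"
proof
  assume "ycoef i s = 0"
  moreover obtain t where t: "s = Suc t"
    using s by (cases s) auto
  moreover have "\<not> m i dvd s"
    using s bound_le[OF i] by (auto dest: dvd_imp_le)
  ultimately have *: "\<gamma> (ab i) * q i i ^ t = 1"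
    using i by (simp add: ycoef_Suc_zero_iff)
  moreover have "t + 2 \<le> m i"
    using s t bound_le[OF i] by simp
  ultimately have t_exp: "is_exponent D \<gamma> i t"
    using i by (simp add: is_exponent_iff)
  then have S: "i \<in> S_set D \<gamma>"
    using i by (auto simp: S_set_def I_def)
  then have "q i i ^ t = q i i ^ e_exp D \<gamma> i"
    using * e_exp[OF S] character_nonzero[OF \<gamma> ab_closed[OF i]] i
    by (simp add: is_exponent_iff) (metis mult_left_cancel)
  then have "t = e_exp D \<gamma> i"
    by (rule q_power_inj[OF i]) (use t_exp e_exp[OF S] i in \<open>auto simp: is_exponent_iff\<close>)
  then show False
    using s t S by (simp add: bound_def)
qed

section \<open>The module of functions on the box\<close>

text \<open>Multi-indices are extensional functions, so that each has a unique representative.\<close>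

definition B :: "(nat \<Rightarrow> nat) set" where
  "B = PiE I (\<lambda>i. {..<bound i})"

lemma finite_B: "finite B"
  by (simp add: B_def finite_PiE)

lemma card_B: "card B = (\<Prod>i\<in>I. bound i)"
  by (simp add: B_def card_PiE)

definition up :: "nat \<Rightarrow> (nat \<Rightarrow> nat) \<Rightarrow> nat \<Rightarrow> nat" where
  "up i \<beta> = \<beta>(i := Suc (\<beta> i))"

definition down :: "nat \<Rightarrow> (nat \<Rightarrow> nat) \<Rightarrow> nat \<Rightarrow> nat" where
  "down i \<beta> = \<beta>(i := \<beta> i - 1)"

lemma up_B: "i \<in> I \<Longrightarrow> up i \<beta> \<in> B \<longleftrightarrow> \<beta> \<in> B \<and> Suc (\<beta> i) < bound i"
  unfolding B_def up_def by (fastforce simp: PiE_iff extensional_def split: if_splits)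

lemma down_B: "i \<in> I \<Longrightarrow> \<beta> \<in> B \<Longrightarrow> down i \<beta> \<in> B"
  unfolding B_def down_def by (auto simp: PiE_iff extensional_def intro: le_less_trans[OF diff_le_self])

lemma up_simps [simp]:
  "down i (up i \<beta>) = \<beta>" "up i \<beta> i = Suc (\<beta> i)" "i \<noteq> j \<Longrightarrow> up i \<beta> j = \<beta> j"
  "0 < \<beta> i \<Longrightarrow> up i (down i \<beta>) = \<beta>" "down i \<beta> i = \<beta> i - 1" "i \<noteq> j \<Longrightarrow> down i \<beta> j = \<beta> j"
  by (auto simp: up_def down_def)

lemma up_down: "i \<noteq> j \<Longrightarrow> down i (up j \<beta>) = up j (down i \<beta>)"
  by (auto simp: up_def down_def)

lemma up_up: "i \<noteq> j \<Longrightarrow> up i (up j \<beta>) = up j (up i \<beta>)"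
  by (auto simp: up_def)

lemma down_down: "i \<noteq> j \<Longrightarrow> down i (down j \<beta>) = down j (down i \<beta>)"
  by (auto simp: down_def)

text \<open>The factor that arises from moving \<open>x\<^sub>i\<close> into its place in the ordered monomial
  \<open>x\<^sup>\<beta>\<close>, past the \<open>x\<^sub>j\<close> with \<open>j < i\<close>.\<close>
definition xcoef :: "nat \<Rightarrow> (nat \<Rightarrow> nat) \<Rightarrow> 'k" where
  "xcoef i \<beta> = (\<Prod>j\<in>{1..<i}. q i j ^ \<beta> j)"

lemma xcoef_up: "i \<in> I \<Longrightarrow> j \<in> I \<Longrightarrow> xcoef i (up j \<beta>) = (if j < i then q i j else 1) * xcoef i \<beta>"
proof -
  assume ij: "i \<in> I" "j \<in> I"
  have "xcoef i (up j \<beta>) = (\<Prod>l\<in>{1..<i}. (if l = j then q i j else 1) * q i l ^ \<beta> l)"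
    unfolding xcoef_def by (rule prod.cong) (auto simp: up_def)
  then show ?thesis
    using I_pos[OF ij(2)] by (simp add: prod.distrib xcoef_def)
qed

lemma xcoef_down: "i \<in> I \<Longrightarrow> j \<in> I \<Longrightarrow> 0 < \<beta> j \<Longrightarrow> xcoef i \<beta> = (if j < i then q i j else 1) * xcoef i (down j \<beta>)"
  using xcoef_up[of i j "down j \<beta>"] by simp

lemma xcoef_nonzero: "i \<in> I \<Longrightarrow> xcoef i \<beta> \<noteq> 0"
  by (auto simp: xcoef_def q_nonzero I_down)

text \<open>The scalar by which a group element acts on the basis vector with multi-index \<open>\<beta>\<close>.\<close>
definition weight :: "'g \<Rightarrow> (nat \<Rightarrow> nat) \<Rightarrow> 'k" where
  "weight h \<beta> = \<gamma> h * (\<Prod>j\<in>I. \<chi> j h ^ \<beta> j)"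

lemma weight_up: "i \<in> I \<Longrightarrow> weight h (up i \<beta>) = \<chi> i h * weight h \<beta>"
proof -
  assume i: "i \<in> I"
  have "(\<Prod>j\<in>I. \<chi> j h ^ up i \<beta> j) = (\<Prod>j\<in>I. (if j = i then \<chi> i h else 1) * \<chi> j h ^ \<beta> j)"
    by (rule prod.cong) (auto simp: up_def)
  then show ?thesis
    using i by (simp add: weight_def prod.distrib)
qed

lemma weight_down: "i \<in> I \<Longrightarrow> 0 < \<beta> i \<Longrightarrow> weight h \<beta> = \<chi> i h * weight h (down i \<beta>)"
  using weight_up[of i h "down i \<beta>"] by simp

lemma weight_ab: "i \<in> I \<Longrightarrow> weight (ab i) \<beta> = \<gamma> (ab i) * (q i i)\<^sup>2 ^ \<beta> i"
proof -
  assume i: "i \<in> I"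
  have "(\<Prod>j\<in>I. \<chi> j (ab i) ^ \<beta> j) = (\<Prod>j\<in>I. if j = i then (q i i)\<^sup>2 ^ \<beta> i else 1)"
    by (rule prod.cong) (use i in \<open>auto simp: \<chi>_ab\<close>)
  then show ?thesis
    using i by (simp add: weight_def)
qed

lemma weight_one: "weight \<one>\<^bsub>G\<^esub> \<beta> = 1"
  by (simp add: weight_def character_one[OF \<gamma>] character_one[OF \<chi>])

lemma weight_mult: "h \<in> carrier G \<Longrightarrow> h' \<in> carrier G \<Longrightarrow> weight (h \<otimes>\<^bsub>G\<^esub> h') \<beta> = weight h \<beta> * weight h' \<beta>"
  by (simp add: weight_def character_mult[OF \<gamma>] character_mult[OF \<chi>] power_mult_distrib prod.distrib)

text \<open>The generators act on the coefficient function \<open>f\<close> of a combination of the ordered monomials.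
  Moving \<open>y\<^sub>i\<close> past the \<open>x\<^sub>j\<close> with \<open>j < i\<close> gives the inverse of the factor for \<open>x\<^sub>i\<close>, since
  \<open>q\<^sub>i\<^sub>j q\<^sub>j\<^sub>i = 1\<close>. Outside the box every generator acts as in the trivial representation, so that the
  defining relations hold on all functions. The guard \<open>0 < \<beta> i\<close> excludes the truncated subtraction in
  \<open>down\<close>.\<close>
fun rho :: "'g generator \<Rightarrow> ((nat \<Rightarrow> nat) \<Rightarrow> 'k) \<Rightarrow> (nat \<Rightarrow> nat) \<Rightarrow> 'k" where
  "rho (gen_G h) f \<beta> = (if \<beta> \<in> B then weight h \<beta> else 1) * f \<beta>"
| "rho (gen_X i) f \<beta> = (if \<beta> \<in> B \<and> 0 < \<beta> i then xcoef i \<beta> else 0) * f (down i \<beta>)"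
| "rho (gen_Y i) f \<beta> = (if up i \<beta> \<in> B then inverse (xcoef i \<beta>) * ycoef i (Suc (\<beta> i)) else 0) * f (up i \<beta>)"

sublocale rho: operator_family rho
proof
  fix x :: "'g generator" and f g :: "(nat \<Rightarrow> nat) \<Rightarrow> 'k" and c
  show "rho x (f + g) = rho x f + rho x g"
    by (cases x) (auto simp: fun_eq_iff plus_fun_apply algebra_simps)
  show "rho x (fscale c f) = fscale c (rho x f)"
    by (cases x) (auto simp: fun_eq_iff fscale_def)
qed

abbreviation "act \<equiv> rho.act"

lemma rho_X_power: "i \<in> I \<Longrightarrow> \<beta> i < s \<Longrightarrow> (rho (gen_X i) ^^ s) f \<beta> = 0"
proof (induction s arbitrary: \<beta>)
  case (Suc s)
  then show ?case
    by (cases "\<beta> \<in> B \<and> 0 < \<beta> i") auto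
qed simp

lemma rho_Y_power: "i \<in> I \<Longrightarrow> bound i \<le> \<beta> i + s \<Longrightarrow> \<beta> \<in> B \<Longrightarrow> (rho (gen_Y i) ^^ s) f \<beta> = 0"
proof (induction s arbitrary: \<beta>)
  case 0
  then show ?case
    by (auto simp: B_def PiE_iff)
next
  case (Suc s)
  then show ?case
    by (cases "up i \<beta> \<in> B") auto
qed

lemma rho_off_box: "\<beta> \<notin> B \<Longrightarrow> i \<in> I \<Longrightarrow> rho (gen_X i) f \<beta> = 0 \<and> rho (gen_Y i) f \<beta> = 0"
  by (simp add: up_B)

lemma rho_power_off_box:
  "\<beta> \<notin> B \<Longrightarrow> i \<in> I \<Longrightarrow> 0 < s \<Longrightarrow> (rho (gen_X i) ^^ s) f \<beta> = 0 \<and> (rho (gen_Y i) ^^ s) f \<beta> = 0"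
  using rho_off_box by (cases s) auto

lemma B_less: "\<beta> \<in> B \<Longrightarrow> i \<in> I \<Longrightarrow> \<beta> i < bound i"
  by (auto simp: B_def PiE_iff)

text \<open>The relations are compared at each multi-index. For \<open>i \<noteq> j\<close> both sides
  contain the same factors \<open>ycoef\<close>, and the factors \<open>xcoef\<close> account for \<open>q\<^sub>i\<^sub>j\<close>. For
  the linking relation with \<open>i = j\<close> the factors \<open>xcoef\<close> cancel, leaving the recursion for \<open>ycoef\<close>; at the upper
  face of the box, where \<open>x\<^sub>i\<close> acts as zero, it persists because \<open>ycoef\<close> vanishes at \<open>bound i\<close>.\<close>
lemma relations_act:
  assumes "r \<in> H_relations D"
  shows "act r f = 0"
proof -
  note simps = fun_eq_iff fscale_def fun_apply_simps rho_off_box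
  have 1: "rho (gen_G \<one>\<^bsub>G\<^esub>) f = f"
    by (auto simp: simps weight_one)
  have 2: "rho (gen_G h) (rho (gen_G h') f) = rho (gen_G (h \<otimes>\<^bsub>G\<^esub> h')) f"
    if "h \<in> carrier G" "h' \<in> carrier G" for h h'
    using that by (auto simp: simps weight_mult)
  have 3: "rho (gen_G h) (rho (gen_X i) f) = fscale (\<chi> i h) (rho (gen_X i) (rho (gen_G h) f))"
    if "h \<in> carrier G" "i \<in> I" for h i
    using that by (auto simp: simps weight_down[of i] down_B)
  have 4: "rho (gen_G h) (rho (gen_Y i) f) = fscale (inverse (\<chi> i h)) (rho (gen_Y i) (rho (gen_G h) f))"
    if "h \<in> carrier G" "i \<in> I" for h i
    using that character_nonzero[OF \<chi>, of i h] by (auto simp: simps weight_up up_B)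
  have 5: "rho (gen_X i) (rho (gen_X j) f) = fscale (q i j) (rho (gen_X j) (rho (gen_X i) f))"
    if "i \<in> I" "j \<in> I" "i \<noteq> j" for i j
  proof
    fix \<beta>
    show "rho (gen_X i) (rho (gen_X j) f) \<beta> = fscale (q i j) (rho (gen_X j) (rho (gen_X i) f)) \<beta>"
    proof (cases "\<beta> \<in> B \<and> 0 < \<beta> i \<and> 0 < \<beta> j")
      case True
      have "xcoef i \<beta> * xcoef j (down i \<beta>) = q i j * (xcoef j \<beta> * xcoef i (down j \<beta>))"
        using True that xcoef_down[of i j \<beta>] xcoef_down[of j i \<beta>] q_sym[of i j] by (auto simp: mult_ac)
      then show ?thesis
        using that True by (simp add: fscale_def down_B down_down mult.assoc[symmetric])
    qed (use that in \<open>auto simp: fscale_def\<close>)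
  qed
  have 6: "rho (gen_Y i) (rho (gen_Y j) f) = fscale (q i j) (rho (gen_Y j) (rho (gen_Y i) f))"
    if "i \<in> I" "j \<in> I" "i \<noteq> j" for i j
  proof
    fix \<beta>
    show "rho (gen_Y i) (rho (gen_Y j) f) \<beta> = fscale (q i j) (rho (gen_Y j) (rho (gen_Y i) f)) \<beta>"
    proof (cases "up i (up j \<beta>) \<in> B")
      case True
      have "inverse (xcoef i \<beta>) * inverse (xcoef j (up i \<beta>)) = q i j * (inverse (xcoef j \<beta>) * inverse (xcoef i (up j \<beta>)))"
        using that q_inverse[of i j] q_inverse[of j i] q_sym[of i j] q_sym[of j i]
        by (auto simp: xcoef_up)
      then show ?thesis
        using that True up_up[of i j \<beta>] by (simp add: fscale_def up_B mult_ac)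
    qed (use that in \<open>auto simp: fscale_def up_B up_up[of i j]\<close>)
  qed
  have 7: "rho (gen_X i) (rho (gen_Y j) f) = fscale (inverse (q i j)) (rho (gen_Y j) (rho (gen_X i) f))"
    if "i \<in> I" "j \<in> I" "i \<noteq> j" for i j
  proof
    fix \<beta>
    show "rho (gen_X i) (rho (gen_Y j) f) \<beta> = fscale (inverse (q i j)) (rho (gen_Y j) (rho (gen_X i) f)) \<beta>"
    proof (cases "up j \<beta> \<in> B \<and> 0 < \<beta> i")
      case True
      have "xcoef i \<beta> * inverse (xcoef j (down i \<beta>)) = inverse (q i j) * (inverse (xcoef j \<beta>) * xcoef i (up j \<beta>))"
        using True that xcoef_up[of i j \<beta>] xcoef_down[of j i \<beta>] q_inverse[of i j] q_inverse[of j i] q_sym[of i j]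
        by (auto simp: mult_ac)
      then show ?thesis
        using that True down_B[of i "up j \<beta>"] by (simp add: fscale_def up_B up_down mult_ac)
    qed (use that down_B[of i "up j \<beta>"] in \<open>auto simp: fscale_def up_B up_down\<close>)
  qed
  have 8: "rho (gen_X i) (rho (gen_Y i) f) =
      fscale (inverse (q i i)) (rho (gen_Y i) (rho (gen_X i) f)) + (rho (gen_G (ab i)) f - f)"
    if i: "i \<in> I" for i
  proof
    fix \<beta>
    have xcoef_self: "xcoef i (up i \<beta>) = xcoef i \<beta>" "0 < \<beta> i \<Longrightarrow> xcoef i (down i \<beta>) = xcoef i \<beta>" for \<beta>
      using xcoef_up[of i i \<beta>] xcoef_down[of i i \<beta>] i by auto
    show "rho (gen_X i) (rho (gen_Y i) f) \<beta> =
      (fscale (inverse (q i i)) (rho (gen_Y i) (rho (gen_X i) f)) + (rho (gen_G (ab i)) f - f)) \<beta>"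
    proof (cases "\<beta> \<in> B")
      case True
      have XY: "rho (gen_X i) (rho (gen_Y i) f) \<beta> = ycoef i (\<beta> i) * f \<beta>"
        using True xcoef_nonzero[OF i, of \<beta>] by (cases "\<beta> i") (auto simp: xcoef_self)
      have "Suc (\<beta> i) = bound i" if "up i \<beta> \<notin> B"
        using that True B_less[OF True i] by (simp add: up_B[OF i])
      then have YX: "rho (gen_Y i) (rho (gen_X i) f) \<beta> = ycoef i (Suc (\<beta> i)) * f \<beta>"
        using xcoef_nonzero[OF i, of \<beta>] i by (auto simp: xcoef_self)
      have eq: "ycoef i (\<beta> i) = inverse (q i i) * ycoef i (Suc (\<beta> i)) + (weight (ab i) \<beta> - 1)"
        using ycoef_step[OF i, of "\<beta> i"] by (simp add: weight_ab[OF i] algebra_simps)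
      then show ?thesis
        using True unfolding XY plus_fun_apply minus_apply fscale_def YX eq by (simp add: algebra_simps)
    next
      case False
      then show ?thesis
        using i by (simp add: fscale_def fun_apply_simps up_B)
    qed
  qed
  have 9: "(rho (gen_X i) ^^ m i) f = 0" "(rho (gen_Y i) ^^ m i) f = 0" if "i \<in> I" for i
  proof -
    have "(rho (gen_X i) ^^ m i) f \<beta> = 0 \<and> (rho (gen_Y i) ^^ m i) f \<beta> = 0" for \<beta>
    proof (cases "\<beta> \<in> B")
      case True
      then show ?thesis
        using rho_X_power[OF that, of \<beta> "m i" f] rho_Y_power[OF that, of \<beta> "m i" f] B_less[OF True that]
          bound_le[OF that] by simp
    next
      case False
      then show ?thesis
        using rho_power_off_box[OF False that, of "m i" f] m_ge[OF that] by simp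
    qed
    then show "(rho (gen_X i) ^^ m i) f = 0" "(rho (gen_Y i) ^^ m i) f = 0"
      by (auto simp: fun_eq_iff zero_fun_apply)
  qed
  have act_letter': "act (letter x) = rho x" for x
    by (rule ext) simp
  let ?g = "\<lambda>h. letter (gen_G h) :: 'g generator list \<Rightarrow>\<^sub>0 'k"
    and ?x = "\<lambda>i. letter (gen_X i) :: 'g generator list \<Rightarrow>\<^sub>0 'k"
    and ?y = "\<lambda>i. letter (gen_Y i) :: 'g generator list \<Rightarrow>\<^sub>0 'k"
  \<comment> \<open>The commutation relations are symmetric in \<open>i\<close> and \<open>j\<close>, so each is used only in the orientation of its own relation.\<close>
  have r1: "act (?g \<one>\<^bsub>G\<^esub> - 1) f = 0"
    by (simp add: 1 del: rho.simps)
  have r2: "act (?g h * ?g h' - ?g (h \<otimes>\<^bsub>G\<^esub> h')) f = 0" if "h \<in> carrier G" "h' \<in> carrier G" for h h'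
    by (simp add: 2[OF that] del: rho.simps)
  have r3: "act (?g h * ?x i - fconst (\<chi> i h) * ?x i * ?g h) f = 0" if "h \<in> carrier G" "i \<in> I" for h i
    by (simp add: 3[OF that] mult.assoc del: rho.simps)
  have r4: "act (?g h * ?y i - fconst (inverse (\<chi> i h)) * ?y i * ?g h) f = 0"
    if "h \<in> carrier G" "i \<in> I" for h i
    by (simp add: 4[OF that] mult.assoc del: rho.simps)
  have r5: "act (?x i * ?x j - fconst (q i j) * ?x j * ?x i) f = 0" if "i \<in> I" "j \<in> I" "i \<noteq> j" for i j
    by (simp add: 5[OF that] mult.assoc del: rho.simps)
  have r6: "act (?y i * ?y j - fconst (q i j) * ?y j * ?y i) f = 0" if "i \<in> I" "j \<in> I" "i \<noteq> j" for i j
    by (simp add: 6[OF that] mult.assoc del: rho.simps)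
  have r7: "act (?x i * ?y j - fconst (inverse (q i j)) * ?y j * ?x i
      - (if i = j then ?g (elA D i \<otimes>\<^bsub>G\<^esub> elB D i) - 1 else 0)) f = 0" if "i \<in> I" "j \<in> I" for i j
    using 7[OF that] 8[OF that(1)] by (auto simp add: mult.assoc ab_def[symmetric] simp del: rho.simps)
  have r9: "act (?x i ^ m i) f = 0" "act (?y i ^ m i) f = 0" if "i \<in> I" for i
    using 9[OF that] by (simp_all only: rho.act_power act_letter')
  show ?thesis
    using assms unfolding H_relations_def Let_def I_def[symmetric]
    by (elim UnE CollectE exE conjE insertE emptyE)
      (simp_all only: r1 r2 r3 r4 r5 r6 r7 r9 simp_thms)
qed

section \<open>Generation and simplicity\<close>

definition origin :: "nat \<Rightarrow> nat" where
  "origin = restrict (\<lambda>_. 0) I"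

definition delta :: "(nat \<Rightarrow> nat) \<Rightarrow> (nat \<Rightarrow> nat) \<Rightarrow> 'k" where
  "delta \<alpha> = (\<lambda>\<beta>. if \<beta> = \<alpha> then 1 else 0)"

abbreviation "v0 \<equiv> delta origin"

definition boxed :: "((nat \<Rightarrow> nat) \<Rightarrow> 'k) \<Rightarrow> bool" where
  "boxed f \<longleftrightarrow> (\<forall>\<beta>. \<beta> \<notin> B \<longrightarrow> f \<beta> = 0)"

abbreviation FA :: "('g generator list \<Rightarrow>\<^sub>0 'k) set" where
  "FA \<equiv> carrier (free_algebra (generators D))"

lemma gens [simp]: "h \<in> carrier G \<Longrightarrow> gen_G h \<in> generators D"
  "i \<in> I \<Longrightarrow> gen_X i \<in> generators D" "i \<in> I \<Longrightarrow> gen_Y i \<in> generators D"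
  by (auto simp: generators_def I_def)

lemma generators_cases:
  assumes "x \<in> generators D"
  obtains (G) h where "h \<in> carrier G" "x = gen_G h" | (X) i where "i \<in> I" "x = gen_X i"
    | (Y) i where "i \<in> I" "x = gen_Y i"
  using assms by (auto simp: generators_def I_def)

lemma origin_B: "origin \<in> B"
  by (simp add: origin_def B_def bound_pos)

lemma origin_I: "i \<in> I \<Longrightarrow> origin i = 0"
  by (simp add: origin_def)

lemma B_neq_origin: "\<beta> \<in> B \<Longrightarrow> \<beta> \<noteq> origin \<Longrightarrow> \<exists>i\<in>I. 0 < \<beta> i"
  by (rule ccontr) (auto simp: B_def origin_def intro!: PiE_ext[of \<beta> I _ "restrict (\<lambda>_. 0) I"] bound_pos)

lemma boxed_delta: "\<beta> \<in> B \<Longrightarrow> boxed (delta \<beta>)"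
  by (auto simp: boxed_def delta_def)

lemma boxed_add: "boxed f \<Longrightarrow> boxed g \<Longrightarrow> boxed (f + g)"
  by (simp add: boxed_def plus_fun_apply)

lemma boxed_scale: "boxed f \<Longrightarrow> boxed (fscale c f)"
  by (simp add: boxed_def fscale_def)

lemma boxed_rho: "x \<in> generators D \<Longrightarrow> boxed f \<Longrightarrow> boxed (rho x f)"
  by (cases x rule: generators_cases) (auto simp: boxed_def up_B)

lemma boxed_act: "p \<in> FA \<Longrightarrow> boxed f \<Longrightarrow> boxed (act p f)"
  unfolding free_algebra_carrier
proof (induction p rule: poly_mapping_keys_induct)
  case (single w c)
  then have "boxed (foldr rho w f)"
    by (induction w) (auto simp: boxed_rho)
  then show ?case
    by (simp add: rho.act_single boxed_scale)
qed (auto simp: boxed_add, simp add: boxed_def zero_fun_apply)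

lemma sum_down: "i \<in> I \<Longrightarrow> 0 < \<beta> i \<Longrightarrow> Suc (sum (down i \<beta>) I) = sum \<beta> I"
proof -
  assume i: "i \<in> I" "0 < \<beta> i"
  have "sum \<beta> I = \<beta> i + sum \<beta> (I - {i})" "sum (down i \<beta>) I = down i \<beta> i + sum (down i \<beta>) (I - {i})"
    using i by (simp_all add: sum.remove)
  moreover have "sum (down i \<beta>) (I - {i}) = sum \<beta> (I - {i})"
    by (rule sum.cong) (auto simp: down_def)
  ultimately show ?thesis
    using i by simp
qed

text \<open>If \<open>f\<close> is nonzero at some multi-index other than the origin, a suitable \<open>y\<^sub>i\<close> maps \<open>f\<close> to a nonzero
  function of smaller total degree, because \<open>ycoef\<close> has no zero strictly inside the box. Iterating
  leads to a nonzero multiple of \<open>v0\<close>.\<close>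
lemma act_reaches_v0:
  assumes "boxed f" "f \<noteq> 0"
  shows "\<exists>r\<in>FA. act r f = v0"
proof -
  \<comment> \<open>induction on a strict bound \<open>n\<close> for the total degree of the support\<close>
  have "\<exists>r\<in>FA. act r f = v0"
    if "boxed f" "f \<noteq> 0" "\<And>\<beta>. f \<beta> \<noteq> 0 \<Longrightarrow> sum \<beta> I < n" for n f
    using that
  proof (induction n arbitrary: f)
    case 0
    then show ?case
      by (auto simp: fun_eq_iff zero_fun_apply)
  next
    case (Suc n)
    show ?case
    proof (cases "\<exists>\<beta>. \<beta> \<noteq> origin \<and> f \<beta> \<noteq> 0")
      case True
      then obtain \<beta> where \<beta>: "\<beta> \<noteq> origin" "f \<beta> \<noteq> 0" by blast
      then have \<beta>B: "\<beta> \<in> B"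
        using Suc.prems(1) by (auto simp: boxed_def)
      then obtain i where i: "i \<in> I" "0 < \<beta> i"
        using B_neq_origin \<beta>(1) by blast
      let ?g = "rho (gen_Y i) f"
      have "?g (down i \<beta>) \<noteq> 0"
        using i \<beta>(2) \<beta>B xcoef_nonzero[OF i(1)] ycoef_nonzero[OF i(1,2)] B_less[OF \<beta>B i(1)] by simp
      then have "?g \<noteq> 0"
        by (metis zero_fun_apply)
      moreover have "boxed ?g"
        by (rule boxed_rho) (use i Suc.prems(1) in auto)
      moreover have "sum \<alpha> I < n" if "?g \<alpha> \<noteq> 0" for \<alpha>
      proof -
        have "f (up i \<alpha>) \<noteq> 0"
          using that by auto
        then have "sum (up i \<alpha>) I < Suc n"
          by (rule Suc.prems(3))
        then show ?thesis
          using sum_down[OF i(1), of "up i \<alpha>"] by simp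
      qed
      ultimately obtain r where r: "r \<in> FA" "act r ?g = v0"
        using Suc.IH by blast
      then have "act (r * letter (gen_Y i)) f = v0"
        by (simp del: rho.simps)
      then show ?thesis
        using r(1) i(1) by (intro bexI[of _ "r * letter (gen_Y i)"]) auto
    next
      case False
      then have f: "f = fscale (f origin) v0"
        by (intro ext) (auto simp: fscale_def delta_def)
      then have "f origin \<noteq> 0"
        using Suc.prems(2) by (metis fscale_simps(5))
      then have "act (fconst (inverse (f origin))) f = v0"
        by (subst f) simp
      then show ?thesis
        by (intro bexI[of _ "fconst (inverse (f origin))"]) auto
    qed
  qed
  moreover have "sum \<beta> I < Suc (Max (insert 0 ((\<lambda>\<beta>. sum \<beta> I) ` B)))" if "f \<beta> \<noteq> 0" for \<beta>
  proof -
    have "\<beta> \<in> B"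
      using that assms(1) by (auto simp: boxed_def)
    then show ?thesis
      using finite_B by (auto simp: less_Suc_eq_le intro!: Max_ge)
  qed
  ultimately show ?thesis
    using assms by blast
qed

lemma delta_reached:
  assumes "\<beta> \<in> B"
  shows "\<exists>r\<in>FA. act r v0 = delta \<beta>"
  using assms
proof (induction "sum \<beta> I" arbitrary: \<beta> rule: less_induct)
  case less
  show ?case
  proof (cases "\<beta> = origin")
    case True
    then show ?thesis
      by (intro bexI[of _ 1]) auto
  next
    case False
    then obtain i where i: "i \<in> I" "0 < \<beta> i"
      using B_neq_origin less.prems by blast
    then have "down i \<beta> \<in> B" "sum (down i \<beta>) I < sum \<beta> I"
      using down_B[OF i(1) less.prems] sum_down[of i \<beta>] by simp_all
    then obtain r where r: "r \<in> FA" "act r v0 = delta (down i \<beta>)"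
      using less.hyps by blast
    have inj: "\<alpha> = \<beta>" if "down i \<alpha> = down i \<beta>" "0 < \<alpha> i" for \<alpha>
      using that i by (metis up_simps(4))
    have "rho (gen_X i) (delta (down i \<beta>)) = fscale (xcoef i \<beta>) (delta \<beta>)"
      using i less.prems by (intro ext) (auto simp: fscale_def delta_def dest: inj)
    then have "act (fconst (inverse (xcoef i \<beta>)) * letter (gen_X i) * r) v0 = delta \<beta>"
      using r(2) xcoef_nonzero[OF i(1), of \<beta>] by (simp del: rho.simps)
    then show ?thesis
      using r(1) i(1) by (intro bexI[of _ "fconst (inverse (xcoef i \<beta>)) * letter (gen_X i) * r"]) auto
  qed
qed

lemma boxed_reached:
  assumes "boxed f"
  shows "\<exists>r\<in>FA. act r v0 = f"
proof -
  have "\<exists>r\<in>FA. act r v0 = (\<lambda>\<beta>. if \<beta> \<in> A then f \<beta> else 0)" if "A \<subseteq> B" for A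
    using finite_subset[OF that finite_B] that
  proof (induction A rule: finite_induct)
    case empty
    show ?case
      by (intro bexI[of _ 0]) (auto simp: fun_eq_iff zero_fun_apply)
  next
    case (insert \<alpha> A)
    then obtain r where r: "r \<in> FA" "act r v0 = (\<lambda>\<beta>. if \<beta> \<in> A then f \<beta> else 0)"
      by auto
    obtain s where s: "s \<in> FA" "act s v0 = delta \<alpha>"
      using delta_reached insert.prems by auto
    have "act (r + fconst (f \<alpha>) * s) v0 = (\<lambda>\<beta>. if \<beta> \<in> insert \<alpha> A then f \<beta> else 0)"
      using insert.hyps by (intro ext) (auto simp: r s plus_fun_apply fscale_def delta_def[of \<alpha>])
    then show ?case
      using r(1) s(1) by (intro bexI[of _ "r + fconst (f \<alpha>) * s"]) auto
  qed
  from this[of B] show ?thesis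
    using assms by (metis (no_types, lifting) boxed_def ext order_refl)
qed

abbreviation xwords :: "'g generator list set" where
  "xwords \<equiv> lists (gen_X ` I)"

text \<open>Each \<open>x\<^sub>i\<close> raises the degree, so only the constant term contributes at the origin.\<close>
lemma act_v0_at_origin: "Poly_Mapping.keys s \<subseteq> xwords \<Longrightarrow> act s v0 origin = Poly_Mapping.lookup s []"
proof (induction s rule: poly_mapping_keys_induct)
  case (single w c)
  then show ?case
    by (cases w) (auto simp: rho.act_single fscale_def delta_def origin_I lookup_single)
qed (auto simp: plus_fun_apply zero_fun_apply lookup_add)

section \<open>The defining ideal and the nilpotency of words in the \<open>x\<^sub>i\<close>\<close>

lemma H_relations_FA: "H_relations D \<subseteq> FA"
  unfolding H_relations_def Let_def I_def[symmetric]
  by (auto simp: mult.assoc)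

interpretation FR: ring "free_algebra (generators D) :: ('g generator list \<Rightarrow>\<^sub>0 'k) ring"
  by (rule ring_free_algebra)

lemma H_ideal_ideal: "ideal (H_ideal D) (free_algebra (generators D))"
  unfolding H_ideal_def by (rule FR.genideal_ideal[OF H_relations_FA])

interpretation HI: ideal "H_ideal D" "free_algebra (generators D)"
  by (rule H_ideal_ideal)

lemma H_ideal_FA: "p \<in> H_ideal D \<Longrightarrow> p \<in> FA"
  using HI.a_subset by auto

lemma H_ideal_rel: "p \<in> H_relations D \<Longrightarrow> p \<in> H_ideal D"
  unfolding H_ideal_def using FR.genideal_self[OF H_relations_FA] by auto

lemma H_ideal_add: "p \<in> H_ideal D \<Longrightarrow> r \<in> H_ideal D \<Longrightarrow> p + r \<in> H_ideal D"
  using HI.a_closed[of p r] by simp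

lemma H_ideal_left: "p \<in> H_ideal D \<Longrightarrow> r \<in> FA \<Longrightarrow> r * p \<in> H_ideal D"
  using HI.I_l_closed[of p r] by simp

lemma H_ideal_right: "p \<in> H_ideal D \<Longrightarrow> r \<in> FA \<Longrightarrow> p * r \<in> H_ideal D"
  using HI.I_r_closed[of p r] by simp

lemma H_ideal_zero: "0 \<in> H_ideal D"
  using HI.zero_closed by simp

text \<open>The elements acting as zero form an ideal, and it contains the relations.\<close>
lemma H_ideal_act: "p \<in> H_ideal D \<Longrightarrow> act p f = 0"
proof -
  let ?A = "{p \<in> FA. \<forall>f. act p f = 0}"
  have "ideal ?A (free_algebra (generators D))"
  proof (rule idealI[OF FR.ring_axioms])
    show "subgroup ?A (add_monoid (free_algebra (generators D)))"
    proof (rule group.subgroupI)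
      show "group (add_monoid (free_algebra (generators D) :: ('g generator list \<Rightarrow>\<^sub>0 'k) ring))"
        by (rule FR.a_group)
      show "?A \<noteq> {}"
        using FA_0 by (auto intro!: exI[of _ 0])
      show "inv\<^bsub>add_monoid (free_algebra (generators D))\<^esub> p \<in> ?A" if "p \<in> ?A" for p
        using that free_algebra_a_inv[of p "generators D"] by (simp add: a_inv_def)
    qed auto
  qed auto
  moreover have "H_relations D \<subseteq> ?A"
    using relations_act H_relations_FA by auto
  ultimately have "H_ideal D \<subseteq> ?A"
    unfolding H_ideal_def by (rule FR.genideal_minimal)
  then show "p \<in> H_ideal D \<Longrightarrow> act p f = 0"
    by auto
qed

lemma rel_GX: "h \<in> carrier G \<Longrightarrow> i \<in> I \<Longrightarrow>
    letter (gen_G h) * letter (gen_X i) - fconst (\<chi> i h) * letter (gen_X i) * letter (gen_G h) \<in> H_ideal D"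
  by (rule H_ideal_rel) (unfold H_relations_def Let_def I_def, blast)

lemma rel_XX: "i \<in> I \<Longrightarrow> j \<in> I \<Longrightarrow> i \<noteq> j \<Longrightarrow>
    letter (gen_X i) * letter (gen_X j) - fconst (q i j) * letter (gen_X j) * letter (gen_X i) \<in> H_ideal D"
  by (rule H_ideal_rel) (unfold H_relations_def Let_def I_def, blast)

lemma rel_XY: "i \<in> I \<Longrightarrow> j \<in> I \<Longrightarrow>
    letter (gen_X i) * letter (gen_Y j) - fconst (inverse (q i j)) * letter (gen_Y j) * letter (gen_X i)
     - (if i = j then letter (gen_G (ab i)) - 1 else 0) \<in> H_ideal D"
  by (rule H_ideal_rel) (unfold H_relations_def Let_def I_def ab_def, blast)

lemma rel_X_power: "i \<in> I \<Longrightarrow> letter (gen_X i) ^ m i \<in> H_ideal D"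
  by (rule H_ideal_rel) (unfold H_relations_def Let_def I_def, blast)

lemma X_past_power:
  assumes "i \<in> I" "j \<in> I" "i \<noteq> j"
  shows "letter (gen_X j) * letter (gen_X i) ^ k
    - fconst (q j i ^ k) * letter (gen_X i) ^ k * letter (gen_X j) \<in> H_ideal D"
proof (induction k)
  case 0
  show ?case
    by (simp add: fconst_simps H_ideal_zero)
next
  case (Suc k)
  let ?x = "letter (gen_X i) :: 'g generator list \<Rightarrow>\<^sub>0 'k" and ?y = "letter (gen_X j) :: 'g generator list \<Rightarrow>\<^sub>0 'k"
  have "?y * ?x ^ Suc k - fconst (q j i ^ Suc k) * ?x ^ Suc k * ?y
    = (?y * ?x - fconst (q j i) * ?x * ?y) * ?x ^ k
      + fconst (q j i) * ?x * (?y * ?x ^ k - fconst (q j i ^ k) * ?x ^ k * ?y)"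
    by (simp add: fconst_arith fconst_fconst)
  then show ?case
    using Suc.IH rel_XX[of j i] assms
    by (simp only:) (intro H_ideal_add H_ideal_left H_ideal_right; simp)
qed

text \<open>The letters \<open>x\<^sub>i\<close> commute up to scalars, so that the occurrences of one of them can be collected at
  the front, where its nilpotency applies.\<close>
lemma collect_letter:
  assumes "w \<in> xwords" "i \<in> I"
  shows "\<exists>c. \<exists>w'\<in>xwords. Poly_Mapping.single w 1
      - fconst c * letter (gen_X i) ^ count_list w (gen_X i) * Poly_Mapping.single w' 1 \<in> H_ideal D"
  using assms(1)
proof (induction w rule: lists.induct)
  case Nil
  show ?case
    by (intro exI[of _ 1] bexI[of _ "[]"]) (auto simp: fconst_simps H_ideal_zero)
next
  case (Cons x w)
  let ?x = "letter (gen_X i) :: 'g generator list \<Rightarrow>\<^sub>0 'k"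
  from Cons.IH obtain c w' where w': "w' \<in> xwords" and
    c: "Poly_Mapping.single w 1 - fconst c * ?x ^ count_list w (gen_X i) * Poly_Mapping.single w' 1 \<in> H_ideal D"
    by blast
  obtain j where j: "j \<in> I" "x = gen_X j"
    using Cons.hyps by auto
  let ?y = "letter (gen_X j) :: 'g generator list \<Rightarrow>\<^sub>0 'k"
  let ?k = "count_list w (gen_X i)"
  have *: "?y * (Poly_Mapping.single w 1 - fconst c * ?x ^ ?k * Poly_Mapping.single w' 1) \<in> H_ideal D"
    using c j by (auto intro: H_ideal_left)
  show ?case
  proof (cases "j = i")
    case True
    have "Poly_Mapping.single (x # w) 1 - fconst c * ?x ^ Suc ?k * Poly_Mapping.single w' 1
        = ?y * (Poly_Mapping.single w 1 - fconst c * ?x ^ ?k * Poly_Mapping.single w' 1)"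
      using True by (simp add: j single_Cons[of "gen_X i" w] fconst_arith fconst_fconst)
    then show ?thesis
      using * True j w' by (intro exI[of _ c] bexI[of _ w']) auto
  next
    case False
    have "Poly_Mapping.single (x # w) 1 - fconst (c * q j i ^ ?k) * ?x ^ ?k * Poly_Mapping.single (gen_X j # w') 1
        = ?y * (Poly_Mapping.single w 1 - fconst c * ?x ^ ?k * Poly_Mapping.single w' 1)
        + fconst c * (?y * ?x ^ ?k - fconst (q j i ^ ?k) * ?x ^ ?k * ?y) * Poly_Mapping.single w' 1"
      by (simp add: j single_Cons[of "gen_X j"] fconst_arith fconst_fconst)
    moreover have "fconst c * (?y * ?x ^ ?k - fconst (q j i ^ ?k) * ?x ^ ?k * ?y) * Poly_Mapping.single w' 1 \<in> H_ideal D"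
      using X_past_power[OF assms(2) j(1)] False w'
      by (intro H_ideal_right H_ideal_left) (auto intro!: FA_single)
    ultimately have "Poly_Mapping.single (x # w) 1
        - fconst (c * q j i ^ ?k) * ?x ^ ?k * Poly_Mapping.single (gen_X j # w') 1 \<in> H_ideal D"
      using * H_ideal_add by simp
    then show ?thesis
      using False w' j by (intro exI[of _ "c * q j i ^ ?k"] bexI[of _ "gen_X j # w'"]) auto
  qed
qed

lemma xwords_sub: "xwords \<subseteq> lists (generators D)"
  by (rule lists_mono) auto

lemma xwords_FA: "w \<in> xwords \<Longrightarrow> Poly_Mapping.single w c \<in> FA"
  by (rule FA_single) auto

text \<open>In a word of this length some \<open>x\<^sub>i\<close> occurs more than \<open>m\<^sub>i\<close> times; after collecting these
  occurrences the word contains the factor \<open>x\<^sub>i\<close> to the power \<open>m\<^sub>i\<close>.\<close>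
lemma long_word_zero:
  assumes "w \<in> xwords" "length w > (\<Sum>i\<in>I. m i)"
  shows "Poly_Mapping.single w 1 \<in> H_ideal D"
proof -
  have "length w = (\<Sum>x\<in>gen_X ` I. count_list w x)"
    using assms(1) by (subst sum_count_set) auto
  also have "\<dots> = (\<Sum>i\<in>I. count_list w (gen_X i))"
    by (subst sum.reindex) (auto simp: inj_on_def)
  finally have "(\<Sum>i\<in>I. m i) < (\<Sum>i\<in>I. count_list w (gen_X i))"
    using assms(2) by simp
  then obtain i where i: "i \<in> I" "m i < count_list w (gen_X i)"
    by (metis sum_mono not_less)
  obtain c w' where w': "w' \<in> xwords" and c: "Poly_Mapping.single w 1
      - fconst c * letter (gen_X i) ^ count_list w (gen_X i) * Poly_Mapping.single w' 1 \<in> H_ideal D"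
    using collect_letter[OF assms(1) i(1)] by blast
  have "letter (gen_X i) ^ m i * letter (gen_X i) ^ (count_list w (gen_X i) - m i) \<in> H_ideal D"
    by (rule H_ideal_right[OF rel_X_power]) (use i in auto)
  then have "letter (gen_X i) ^ count_list w (gen_X i) \<in> H_ideal D"
    using i(2) by (simp flip: power_add)
  then have "fconst c * letter (gen_X i) ^ count_list w (gen_X i) * Poly_Mapping.single w' 1 \<in> H_ideal D"
    using xwords_FA[OF w'] by (intro H_ideal_right H_ideal_left) auto
  from H_ideal_add[OF c this] show ?thesis
    by simp
qed

section \<open>Left ideals containing the highest weight relations\<close>

text \<open>These left ideals correspond to the submodules of \<open>Z(\<gamma>)\<close>: to a submodule belongs the set of all
  \<open>p\<close> with \<open>p 1\<^sub>\<gamma>\<close> in it.\<close>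

definition highest_weight :: "('g generator list \<Rightarrow>\<^sub>0 'k) set \<Rightarrow> bool" where
  "highest_weight N \<longleftrightarrow> N \<subseteq> FA \<and> H_ideal D \<subseteq> N \<and> (\<forall>p\<in>N. \<forall>r\<in>N. p + r \<in> N) \<and> (\<forall>r\<in>FA. \<forall>p\<in>N. r * p \<in> N) \<and>
     (\<forall>h\<in>carrier G. letter (gen_G h) - fconst (\<gamma> h) \<in> N) \<and> (\<forall>i\<in>I. letter (gen_Y i) \<in> N)"

lemma highest_weightD:
  assumes "highest_weight N"
  shows "p \<in> N \<Longrightarrow> p \<in> FA" "p \<in> H_ideal D \<Longrightarrow> p \<in> N" "p \<in> N \<Longrightarrow> r \<in> N \<Longrightarrow> p + r \<in> N"
    "s \<in> FA \<Longrightarrow> p \<in> N \<Longrightarrow> s * p \<in> N" "h \<in> carrier G \<Longrightarrow> letter (gen_G h) - fconst (\<gamma> h) \<in> N"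
    "i \<in> I \<Longrightarrow> letter (gen_Y i) \<in> N" "p \<in> N \<Longrightarrow> - p \<in> N" "p \<in> N \<Longrightarrow> r \<in> N \<Longrightarrow> p - r \<in> N" "0 \<in> N"
proof -
  note h = assms[unfolded highest_weight_def]
  show "p \<in> N \<Longrightarrow> p \<in> FA" "p \<in> H_ideal D \<Longrightarrow> p \<in> N" and add: "\<And>p r. p \<in> N \<Longrightarrow> r \<in> N \<Longrightarrow> p + r \<in> N"
    and mult: "\<And>s p. s \<in> FA \<Longrightarrow> p \<in> N \<Longrightarrow> s * p \<in> N" "h \<in> carrier G \<Longrightarrow> letter (gen_G h) - fconst (\<gamma> h) \<in> N"
    "i \<in> I \<Longrightarrow> letter (gen_Y i) \<in> N"
    using h by auto
  show minus: "\<And>p. p \<in> N \<Longrightarrow> - p \<in> N"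
    using mult(1)[of "- 1"] by simp
  show "p \<in> N \<Longrightarrow> r \<in> N \<Longrightarrow> p - r \<in> N"
    using add[of p "- r"] minus[of r] by simp
  show "0 \<in> N"
    using h H_ideal_zero by auto
qed

context
  fixes N assumes N: "highest_weight N"
begin

definition normalizable :: "('g generator list \<Rightarrow>\<^sub>0 'k) \<Rightarrow> bool" where
  "normalizable p \<longleftrightarrow> (\<exists>s. Poly_Mapping.keys s \<subseteq> xwords \<and> p - s \<in> N)"

lemma normalizable_keys: "Poly_Mapping.keys s \<subseteq> xwords \<Longrightarrow> normalizable s"
  unfolding normalizable_def using highest_weightD(9)[OF N] by (intro exI[of _ s]) auto

lemma normalizable_cong: "p - r \<in> N \<Longrightarrow> normalizable r \<Longrightarrow> normalizable p"
  unfolding normalizable_def using highest_weightD(3)[OF N, of "p - r"] by fastforce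

lemma normalizable_add: "normalizable p \<Longrightarrow> normalizable r \<Longrightarrow> normalizable (p + r)"
proof -
  assume "normalizable p" "normalizable r"
  then obtain s t where st: "Poly_Mapping.keys s \<subseteq> xwords" "Poly_Mapping.keys t \<subseteq> xwords" "p - s \<in> N" "r - t \<in> N"
    by (auto simp: normalizable_def)
  then have "Poly_Mapping.keys (s + t) \<subseteq> xwords" "(p + r) - (s + t) \<in> N"
    using keys_add[of s t] highest_weightD(3)[OF N st(3,4)] by (auto simp: algebra_simps)
  then show ?thesis
    unfolding normalizable_def by blast
qed

lemma keys_mult_xwords: fixes s :: "'g generator list \<Rightarrow>\<^sub>0 'k" shows "Poly_Mapping.keys s \<subseteq> xwords \<Longrightarrow> Poly_Mapping.keys t \<subseteq> xwords \<Longrightarrow> Poly_Mapping.keys (s * t) \<subseteq> xwords"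
  using FA_mult[of s "gen_X ` I" t] by (simp add: free_algebra_carrier)

lemma normalizable_mult_xwords:
  assumes "Poly_Mapping.keys t \<subseteq> xwords" "normalizable p"
  shows "normalizable (t * p)"
proof -
  obtain s where s: "Poly_Mapping.keys s \<subseteq> xwords" "p - s \<in> N"
    using assms(2) by (auto simp: normalizable_def)
  have "t \<in> FA"
    using order_trans[OF assms(1) xwords_sub] by (simp add: free_algebra_carrier)
  then have "t * p - t * s \<in> N"
    using highest_weightD(4)[OF N _ s(2), of t] by (simp add: algebra_simps)
  then show ?thesis
    using keys_mult_xwords[OF assms(1) s(1)] unfolding normalizable_def by blast
qed

lemma normalizable_fconst: "normalizable p \<Longrightarrow> normalizable (fconst c * p)"
  by (rule normalizable_mult_xwords) (auto simp: fconst_def)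

text \<open>A group element moves through the word at the cost of a scalar and is then absorbed by the
  highest weight relation.\<close>
lemma G_word:
  assumes h: "h \<in> carrier G" and "w \<in> xwords"
  shows "\<exists>c. letter (gen_G h) * Poly_Mapping.single w 1 - fconst c * Poly_Mapping.single w 1 \<in> N"
  using assms(2)
proof (induction w rule: lists.induct)
  case Nil
  show ?case
    using highest_weightD(5)[OF N h] by (intro exI[of _ "\<gamma> h"]) (simp add: single_Nil_one)
next
  case (Cons x w)
  then obtain c i where c: "letter (gen_G h) * Poly_Mapping.single w 1 - fconst c * Poly_Mapping.single w 1 \<in> N"
    and i: "i \<in> I" "x = gen_X i"
    by auto
  let ?g = "letter (gen_G h) :: 'g generator list \<Rightarrow>\<^sub>0 'k" and ?x = "letter (gen_X i) :: 'g generator list \<Rightarrow>\<^sub>0 'k"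
  let ?w = "Poly_Mapping.single w (1 :: 'k)"
  have "?g * (?x * ?w) - fconst (\<chi> i h * c) * (?x * ?w) =
     (?g * ?x - fconst (\<chi> i h) * ?x * ?g) * ?w + fconst (\<chi> i h) * ?x * (?g * ?w - fconst c * ?w)"
    by (simp add: fconst_arith fconst_fconst)
  moreover have "(?g * ?x - fconst (\<chi> i h) * ?x * ?g) * ?w \<in> N"
    using rel_GX[OF h i(1)] xwords_FA[OF Cons.hyps(2)] by (intro highest_weightD(2)[OF N] H_ideal_right)
  moreover have "fconst (\<chi> i h) * ?x * (?g * ?w - fconst c * ?w) \<in> N"
    using c i by (intro highest_weightD(4)[OF N]) auto
  ultimately have "?g * (?x * ?w) - fconst (\<chi> i h * c) * (?x * ?w) \<in> N"
    using highest_weightD(3)[OF N] by simp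
  then show ?case
    unfolding i(2) single_Cons by blast
qed

lemma normalizable_G_word:
  "h \<in> carrier G \<Longrightarrow> w \<in> xwords \<Longrightarrow> normalizable (letter (gen_G h) * Poly_Mapping.single w 1)"
  using G_word[of h w] normalizable_cong normalizable_fconst normalizable_keys[of "Poly_Mapping.single w 1"]
  by (metis Poly_Mapping.keys_single empty_subsetI insert_subset)

text \<open>Moving \<open>y\<^sub>j\<close> past the first letter of the word produces, besides a shorter instance of the same
  problem, at most a group element in front of a word. At the end of the word, \<open>y\<^sub>j\<close> lies in \<open>N\<close>.\<close>
lemma normalizable_Y_word:
  assumes j: "j \<in> I" and "w \<in> xwords"
  shows "normalizable (letter (gen_Y j) * Poly_Mapping.single w 1)"
  using assms(2)
proof (induction w rule: lists.induct)
  case Nil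
  show ?case
    using highest_weightD(6)[OF N j] normalizable_keys[of 0] normalizable_cong[of "letter (gen_Y j)" 0]
    by (simp add: single_Nil_one)
next
  case (Cons x w)
  then obtain i where i: "i \<in> I" "x = gen_X i"
    by auto
  let ?y = "letter (gen_Y j) :: 'g generator list \<Rightarrow>\<^sub>0 'k" and ?x = "letter (gen_X i) :: 'g generator list \<Rightarrow>\<^sub>0 'k"
  let ?w = "Poly_Mapping.single w (1 :: 'k)" and ?q = "fconst (q i j) :: 'g generator list \<Rightarrow>\<^sub>0 'k"
  let ?e = "if i = j then letter (gen_G (ab i)) - 1 else 0 :: 'g generator list \<Rightarrow>\<^sub>0 'k"
  have qq: "?q * (fconst (inverse (q i j)) * p) = p" for p :: "'g generator list \<Rightarrow>\<^sub>0 'k"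
    using q_nonzero[OF i(1) j] by (simp add: fconst_fconst fconst_simps(4))
  have "?y * (?x * ?w) - (?q * ?x * (?y * ?w) + - ?q * (?e * ?w))
    = - ?q * ((?x * ?y - fconst (inverse (q i j)) * ?y * ?x - ?e) * ?w)"
    by (simp only: mult.assoc left_diff_distrib right_diff_distrib mult_minus_left qq) simp
  also have "\<dots> \<in> N"
    using rel_XY[OF i(1) j] xwords_FA[OF Cons.hyps(2)]
    by (intro highest_weightD(2,4)[OF N] H_ideal_right) auto
  finally have *: "?y * (?x * ?w) - (?q * ?x * (?y * ?w) + - ?q * (?e * ?w)) \<in> N" .
  have "normalizable (?e * ?w)"
  proof (cases "i = j")
    case True
    have "normalizable (letter (gen_G (ab i)) * ?w + fconst (- 1) * ?w)"
      using normalizable_G_word[OF ab_closed[OF i(1)] Cons.hyps(2)] normalizable_keys[of ?w] Cons.hyps(2)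
      by (intro normalizable_add normalizable_fconst) auto
    then show ?thesis
      using True by (simp add: fconst_simps algebra_simps)
  qed (simp add: normalizable_keys)
  then have "normalizable (fconst (- q i j) * (?e * ?w))"
    by (rule normalizable_fconst)
  moreover have "normalizable ((?q * ?x) * (?y * ?w))"
    by (rule normalizable_mult_xwords[OF _ Cons.IH]) (use i(1) in \<open>auto simp: fconst_def letter_def mult_single_list\<close>)
  ultimately have "normalizable (?q * ?x * (?y * ?w) + - ?q * (?e * ?w))"
    by (intro normalizable_add) (simp_all add: fconst_simps)
  from normalizable_cong[OF * this] show ?case
    unfolding i(2) single_Cons .
qed

lemma normalizable_letter:
  assumes x: "x \<in> generators D" and p: "normalizable p"
  shows "normalizable (letter x * p)"
proof -
  obtain s where s: "Poly_Mapping.keys s \<subseteq> xwords" "p - s \<in> N"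
    using p by (auto simp: normalizable_def)
  have word: "normalizable (letter x * Poly_Mapping.single w 1)" if "w \<in> xwords" for w
    using x
  proof (cases x rule: generators_cases)
    case (X i)
    then show ?thesis
      using that by (intro normalizable_keys) (auto simp flip: single_Cons)
  qed (use that normalizable_G_word normalizable_Y_word in auto)
  have "normalizable (letter x * s)"
    using s(1)
  proof (induction s rule: poly_mapping_keys_induct)
    case (single w c)
    have "letter x * Poly_Mapping.single w c = fconst c * (letter x * Poly_Mapping.single w 1)"
      by (subst single_eq_fconst_mult) (simp only: mult.assoc fconst_commute[of c])
    then show ?case
      using normalizable_fconst[OF word[OF single]] by simp
  qed (auto simp: distrib_left normalizable_add normalizable_keys)
  moreover have "letter x * p - letter x * s \<in> N"
    using highest_weightD(4)[OF N _ s(2), of "letter x"] x by (simp add: algebra_simps)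
  ultimately show ?thesis
    by (rule normalizable_cong[rotated])
qed

text \<open>The triangular decomposition, in the form needed here: modulo \<open>N\<close> the words in the \<open>x\<^sub>i\<close> span
  everything.\<close>
lemma normal_form: "p \<in> FA \<Longrightarrow> normalizable p"
  unfolding free_algebra_carrier
proof (induction p rule: poly_mapping_keys_induct)
  case (single w c)
  then show ?case
  proof (induction w)
    case Nil
    show ?case
      by (rule normalizable_keys) auto
  next
    case (Cons x w)
    then show ?case
      by (simp add: single_Cons normalizable_letter)
  qed
qed (auto simp: normalizable_add normalizable_keys)

text \<open>A combination of words in the \<open>x\<^sub>i\<close> with nonzero constant term is a unit of \<open>H\<close>. In terms of \<open>N\<close>:
  multiplying \<open>s\<close> on the left by a word shows that this word lies in \<open>N\<close> if all longer words do,
  and this descends from the words that are so long that they vanish to the empty word.\<close>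
lemma one_from_unit:
  assumes s: "Poly_Mapping.keys s \<subseteq> xwords" "Poly_Mapping.lookup s [] \<noteq> 0" "s \<in> N"
  shows "1 \<in> N"
proof -
  let ?L = "\<Sum>i\<in>I. m i" and ?c = "Poly_Mapping.lookup s []"
  define t where "t = s - Poly_Mapping.single [] ?c"
  have t_keys: "Poly_Mapping.keys t \<subseteq> xwords - {[]}"
    using s(1) by (auto simp: t_def in_keys_iff lookup_minus lookup_single when_def split: if_splits)
  \<comment> \<open>\<open>n\<close> bounds by how much a word may fall short of the length from which on all words vanish\<close>
  have "\<forall>w\<in>xwords. ?L < length w + n \<longrightarrow> Poly_Mapping.single w 1 \<in> N" for n
  proof (induction n)
    case 0
    show ?case
      using long_word_zero highest_weightD(2)[OF N] by auto
  next
    case (Suc n)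
    show ?case
    proof (intro ballI impI)
      fix w assume w: "w \<in> xwords" and len: "?L < length w + Suc n"
      have "Poly_Mapping.single w 1 * t \<in> N"
        using t_keys
      proof (induction t rule: poly_mapping_keys_induct)
        case (single v b)
        then have "Poly_Mapping.single (w @ v) 1 \<in> N"
          using Suc.IH len w by (cases v) auto
        then have "fconst b * Poly_Mapping.single (w @ v) 1 \<in> N"
          by (intro highest_weightD(4)[OF N]) auto
        then show ?case
          by (simp add: mult_single_list fconst_def)
      qed (use highest_weightD(3,9)[OF N] in \<open>auto simp: distrib_left\<close>)
      moreover have "Poly_Mapping.single w 1 * s \<in> N"
        by (rule highest_weightD(4)[OF N xwords_FA[OF w] s(3)])
      ultimately have "Poly_Mapping.single w 1 * s - Poly_Mapping.single w 1 * t \<in> N"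
        by (rule highest_weightD(8)[OF N, rotated])
      then have "fconst (inverse ?c) * Poly_Mapping.single w ?c \<in> N"
        by (intro highest_weightD(4)[OF N]) (simp_all add: t_def algebra_simps mult_single_list)
      then show "Poly_Mapping.single w 1 \<in> N"
        using s(2) by (simp add: fconst_def mult_single_list)
    qed
  qed
  from this[of "Suc ?L"] have "Poly_Mapping.single [] 1 \<in> N"
    by auto
  then show ?thesis
    by (simp add: single_Nil_one)
qed

end

text \<open>The left ideal that belongs to the kernel of the homomorphism \<open>p 1\<^sub>\<gamma> \<mapsto> p v\<^sub>0\<close>.\<close>
definition annihilator :: "('g generator list \<Rightarrow>\<^sub>0 'k) set" where
  "annihilator = {p \<in> FA. act p v0 = 0}"

lemma rho_G_v0: "rho (gen_G h) v0 = fscale (\<gamma> h) v0"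
  by (intro ext) (auto simp: fscale_def delta_def origin_B weight_def origin_I)

lemma rho_Y_v0: "i \<in> I \<Longrightarrow> rho (gen_Y i) v0 = 0"
  using origin_I[of i] up_simps(2)[of i] by (auto simp: fun_eq_iff zero_fun_apply delta_def) (metis nat.distinct(1) up_simps(2))

lemma highest_weight_annihilator: "highest_weight annihilator"
  unfolding highest_weight_def annihilator_def
  using H_ideal_act H_ideal_FA by (auto simp: rho_G_v0 rho_Y_v0 simp del: rho.simps)

text \<open>So the annihilator of \<open>v0\<close> corresponds to the unique maximal submodule: by irreducibility, a highest
  weight left ideal with an element outside it has one fixing \<open>v0\<close>, and then also
  a unit.\<close>
lemma one_in_highest_weight:
  assumes N: "highest_weight N" and p: "p \<in> N" "act p v0 \<noteq> 0"
  shows "1 \<in> N"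
proof -
  have p_FA: "p \<in> FA"
    using highest_weightD(1)[OF N p(1)] .
  obtain r where r: "r \<in> FA" "act r (act p v0) = v0"
    using act_reaches_v0[OF boxed_act[OF p_FA boxed_delta[OF origin_B]] p(2)] by blast
  \<comment> \<open>normal forms are taken modulo the intersection, so that they stay in \<open>N\<close> and act alike on \<open>v0\<close>\<close>
  have highest_weight_Int: "highest_weight (N \<inter> annihilator)"
    unfolding highest_weight_def[of "N \<inter> annihilator"] using highest_weightD[OF N] highest_weightD[OF highest_weight_annihilator]
    by (intro conjI ballI subsetI IntI) (simp_all only: Int_iff)
  have "normalizable (N \<inter> annihilator) (r * p)"
    by (rule normal_form[OF highest_weight_Int FA_mult[OF r(1) p_FA]])
  then obtain s where s: "Poly_Mapping.keys s \<subseteq> xwords" "r * p - s \<in> N \<inter> annihilator"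
    unfolding normalizable_def[OF highest_weight_Int] by blast
  have "act s v0 = v0"
    using s(2) r(2) by (simp add: annihilator_def)
  then have "Poly_Mapping.lookup s [] = 1"
    using act_v0_at_origin[OF s(1)] by (simp add: delta_def)
  moreover have "s \<in> N"
    using highest_weightD(8)[OF N highest_weightD(4)[OF N r(1) p(1)], of "r * p - s"] s(2) by simp
  ultimately show ?thesis
    using one_from_unit[OF N s(1)] by simp
qed

section \<open>The algebra and the subalgebra generated by \<open>G\<close> and the \<open>y\<^sub>i\<close>\<close>

lemma ring_H: "ring (H_alg D)"
  unfolding H_alg_def by (rule HI.quotient_is_ring)

interpretation H: ring "H_alg D"
  by (rule ring_H)

lemma H_class_hom: "H_class D \<in> Ring.ring_hom (free_algebra (generators D)) (H_alg D)"
  using HI.rcos_ring_hom unfolding H_alg_def H_class_def[abs_def] .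

lemma H_class_closed [simp]: "p \<in> FA \<Longrightarrow> H_class D p \<in> carrier (H_alg D)"
  and H_class_add: "p \<in> FA \<Longrightarrow> r \<in> FA \<Longrightarrow> H_class D (p + r) = H_class D p \<oplus>\<^bsub>H_alg D\<^esub> H_class D r"
  and H_class_mult: "p \<in> FA \<Longrightarrow> r \<in> FA \<Longrightarrow> H_class D (p * r) = H_class D p \<otimes>\<^bsub>H_alg D\<^esub> H_class D r"
  and H_class_one: "H_class D 1 = \<one>\<^bsub>H_alg D\<^esub>"
  using ring_hom_closed[OF H_class_hom, of p] ring_hom_add[OF H_class_hom, of p r]
    ring_hom_mult[OF H_class_hom, of p r] ring_hom_one[OF H_class_hom]
  by simp_all

lemma H_class_surj:
  assumes "u \<in> carrier (H_alg D)"
  obtains p where "p \<in> FA" "u = H_class D p"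
  using assms by (auto simp: H_alg_def FactRing_def A_RCOSETS_def RCOSETS_def H_class_def a_r_coset_def)

lemma H_class_eqI:
  assumes "p \<in> FA" "r \<in> FA" "p - r \<in> H_ideal D"
  shows "H_class D p = H_class D r"
proof -
  have "p \<in> H_ideal D +>\<^bsub>free_algebra (generators D)\<^esub> r"
    unfolding a_r_coset_def r_coset_def
    using assms(3) by (auto intro!: bexI[of _ "p - r"])
  then show ?thesis
    unfolding H_class_def using FR.add.repr_independence[OF _ _ HI.a_subgroup, of p r] assms(2)
    by (simp add: a_r_coset_def)
qed

lemma H_class_eqD:
  assumes "p \<in> FA" "H_class D p = H_class D r"
  shows "p - r \<in> H_ideal D"
proof -
  have "p \<in> H_class D r"
    using HI.a_rcos_self[OF assms(1)] assms(2) by (simp add: H_class_def)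
  then show ?thesis
    unfolding H_class_def a_r_coset_def r_coset_def by auto
qed

lemma H_scalar_commute: "u \<in> carrier (H_alg D) \<Longrightarrow>
    u \<otimes>\<^bsub>H_alg D\<^esub> H_scalar D c = H_scalar D c \<otimes>\<^bsub>H_alg D\<^esub> u"
  by (erule H_class_surj) (simp add: H_scalar_def fconst_commute flip: H_class_mult)

lemma H_scalar_closed [simp]: "H_scalar D c \<in> carrier (H_alg D)"
  by (simp add: H_scalar_def)

lemma H_uminus: "u \<in> carrier (H_alg D) \<Longrightarrow> \<ominus>\<^bsub>H_alg D\<^esub> u = H_scalar D (- 1) \<otimes>\<^bsub>H_alg D\<^esub> u"
proof (rule H.minus_equality)
  assume u: "u \<in> carrier (H_alg D)"
  then obtain p where p: "p \<in> FA" "u = H_class D p"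
    by (rule H_class_surj)
  have "H_class D 0 = \<zero>\<^bsub>H_alg D\<^esub>"
    using H_class_add[of 0 0] H.add.r_cancel_one'[of "H_class D 0" "H_class D 0"] by simp
  then show "H_scalar D (- 1) \<otimes>\<^bsub>H_alg D\<^esub> u \<oplus>\<^bsub>H_alg D\<^esub> u = \<zero>\<^bsub>H_alg D\<^esub>"
    using p by (simp add: H_scalar_def fconst_simps flip: H_class_mult H_class_add)
qed simp_all

text \<open>The action does not depend on the chosen representative, as the defining ideal acts as zero.\<close>
definition Hact :: "('g generator list \<Rightarrow>\<^sub>0 'k) set \<Rightarrow> ((nat \<Rightarrow> nat) \<Rightarrow> 'k) \<Rightarrow> (nat \<Rightarrow> nat) \<Rightarrow> 'k" where
  "Hact u = act (SOME p. p \<in> FA \<and> H_class D p = u)"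

lemma Hact_class: "p \<in> FA \<Longrightarrow> Hact (H_class D p) f = act p f"
proof -
  assume p: "p \<in> FA"
  define r where "r = (SOME r. r \<in> FA \<and> H_class D r = H_class D p)"
  have r: "r \<in> FA" "H_class D r = H_class D p"
    using someI[of "\<lambda>r. r \<in> FA \<and> H_class D r = H_class D p" p] p by (auto simp: r_def)
  then have "r - p \<in> H_ideal D"
    by (intro H_class_eqD)
  then have "act (r - p) f = 0"
    by (rule H_ideal_act)
  then show ?thesis
    by (simp add: Hact_def r_def)
qed

lemma Hact_add: "u \<in> carrier (H_alg D) \<Longrightarrow> w \<in> carrier (H_alg D) \<Longrightarrow>
    Hact (u \<oplus>\<^bsub>H_alg D\<^esub> w) f = Hact u f + Hact w f"
  and Hact_mult: "u \<in> carrier (H_alg D) \<Longrightarrow> w \<in> carrier (H_alg D) \<Longrightarrow>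
    Hact (u \<otimes>\<^bsub>H_alg D\<^esub> w) f = Hact u (Hact w f)"
  by (elim H_class_surj; simp add: Hact_class flip: H_class_add H_class_mult)+

lemma Hact_scalar [simp]: "Hact (H_scalar D c) f = fscale c f"
  by (simp add: H_scalar_def Hact_class)

lemma Hact_scale: "u \<in> carrier (H_alg D) \<Longrightarrow> Hact u (fscale c f) = fscale c (Hact u f)"
  by (elim H_class_surj) (simp add: Hact_class)

abbreviation "Ygens \<equiv> range (H_scalar D) \<union> (\<lambda>h. H_class D (letter (gen_G h))) ` carrier G
    \<union> (\<lambda>i. H_class D (letter (gen_Y i))) ` I"

lemma Y_set_eq: "Y_set D = generate_ring (H_alg D) Ygens"
  by (simp add: Y_set_def I_def)

lemma Ygens_carrier: "Ygens \<subseteq> carrier (H_alg D)"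
  by auto

lemma Y_carrier: "u \<in> Y_set D \<Longrightarrow> u \<in> carrier (H_alg D)"
  unfolding Y_set_eq by (rule H.generate_ring_in_carrier[OF Ygens_carrier])

lemma Y_gens: "H_scalar D c \<in> Y_set D" "h \<in> carrier G \<Longrightarrow> H_class D (letter (gen_G h)) \<in> Y_set D"
  "i \<in> I \<Longrightarrow> H_class D (letter (gen_Y i)) \<in> Y_set D"
  unfolding Y_set_eq by (rule generate_ring.incl, blast)+

lemma Y_closed: "\<one>\<^bsub>H_alg D\<^esub> \<in> Y_set D" "u \<in> Y_set D \<Longrightarrow> w \<in> Y_set D \<Longrightarrow> u \<oplus>\<^bsub>H_alg D\<^esub> w \<in> Y_set D"
  "u \<in> Y_set D \<Longrightarrow> w \<in> Y_set D \<Longrightarrow> u \<otimes>\<^bsub>H_alg D\<^esub> w \<in> Y_set D"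
  unfolding Y_set_eq by (blast intro: generate_ring.intros)+

lemma Y_induct [consumes 1, case_names scalar G Y add mult]:
  assumes "u \<in> Y_set D"
    and scalar: "\<And>c. P (H_scalar D c)"
    and "\<And>h. h \<in> carrier G \<Longrightarrow> P (H_class D (letter (gen_G h)))"
    and "\<And>i. i \<in> I \<Longrightarrow> P (H_class D (letter (gen_Y i)))"
    and "\<And>u w. u \<in> Y_set D \<Longrightarrow> w \<in> Y_set D \<Longrightarrow> P u \<Longrightarrow> P w \<Longrightarrow> P (u \<oplus>\<^bsub>H_alg D\<^esub> w)"
    and mult: "\<And>u w. u \<in> Y_set D \<Longrightarrow> w \<in> Y_set D \<Longrightarrow> P u \<Longrightarrow> P w \<Longrightarrow> P (u \<otimes>\<^bsub>H_alg D\<^esub> w)"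
  shows "P u"
  using assms(1) unfolding Y_set_eq
proof (induction u rule: generate_ring.induct)
  case one
  show ?case
    using scalar[of 1] by (simp add: H_scalar_def fconst_simps H_class_one)
next
  case (a_inv u)
  then show ?case
    using mult[OF Y_gens(1) _ scalar, of u "- 1"] H_uminus[of u] Y_carrier[of u] by (simp add: Y_set_eq)
qed (use assms in \<open>auto simp: Y_set_eq\<close>)

text \<open>The character of \<open>Y\<close> through which it acts on \<open>k\<^sub>\<gamma>\<close>. That such a character exists is not visible from
  the presentation of \<open>H\<close>; it is read off from the line spanned by \<open>v0\<close>.\<close>
definition eps :: "('g generator list \<Rightarrow>\<^sub>0 'k) set \<Rightarrow> 'k" where
  "eps u = Hact u v0 origin"

lemma eps_eq: "Hact u v0 = fscale c v0 \<Longrightarrow> eps u = c"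
  by (simp add: eps_def fscale_def delta_def)

lemma Hact_Y: "u \<in> Y_set D \<Longrightarrow> Hact u v0 = fscale (eps u) v0"
proof -
  assume "u \<in> Y_set D"
  then have "\<exists>c. Hact u v0 = fscale c v0"
  proof (induction u rule: Y_induct)
    case (Y i)
    then show ?case
      by (intro exI[of _ 0]) (simp add: Hact_class rho_Y_v0 del: rho.simps)
  next
    case (add u w)
    then obtain c c' where "Hact u v0 = fscale c v0" "Hact w v0 = fscale c' v0"
      by auto
    then show ?case
      using add.hyps by (intro exI[of _ "c + c'"]) (simp add: Hact_add Y_carrier)
  next
    case (mult u w)
    then show ?case
      by (auto simp: Hact_mult Hact_scale Y_carrier)
  qed (auto simp: Hact_class rho_G_v0 simp del: rho.simps)
  then show ?thesis
    using eps_eq by auto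
qed

lemma eps_simps [simp]:
  "eps (H_scalar D c) = c" "h \<in> carrier G \<Longrightarrow> eps (H_class D (letter (gen_G h))) = \<gamma> h"
  "i \<in> I \<Longrightarrow> eps (H_class D (letter (gen_Y i))) = 0"
  "u \<in> Y_set D \<Longrightarrow> w \<in> Y_set D \<Longrightarrow> eps (u \<oplus>\<^bsub>H_alg D\<^esub> w) = eps u + eps w"
  "u \<in> Y_set D \<Longrightarrow> w \<in> Y_set D \<Longrightarrow> eps (u \<otimes>\<^bsub>H_alg D\<^esub> w) = eps u * eps w"
  "eps \<one>\<^bsub>H_alg D\<^esub> = 1"
  by (rule eps_eq, simp add: Hact_class rho_G_v0 rho_Y_v0 Hact_add Hact_mult Hact_scale Y_carrier Hact_Y
      mult.commute del: rho.simps flip: H_class_one; fail)+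

abbreviation Kact :: "('g generator list \<Rightarrow>\<^sub>0 'k) set \<Rightarrow> 'k \<Rightarrow> 'k" where
  "Kact \<equiv> restrict (\<lambda>u v. eps u * v) (Y_set D)"

lemma Y_alg_simps: "carrier (Y_alg D) = Y_set D" "add (Y_alg D) = add (H_alg D)"
  "mult (Y_alg D) = mult (H_alg D)" "\<one>\<^bsub>Y_alg D\<^esub> = \<one>\<^bsub>H_alg D\<^esub>"
  by (simp_all add: Y_alg_def)

lemma line_simps: "carrier (line a) = UNIV" "v \<oplus>\<^bsub>line a\<^esub> w = v + w" "u \<odot>\<^bsub>line a\<^esub> v = a u v"
  by (simp_all add: line_def)

lemma left_module_line: "left_module (Y_alg D) (line Kact)"
proof (rule left_module.intro)
  show "ring (Y_alg D)"
    unfolding Y_alg_def Y_set_eq by (rule H.generate_ring_is_ring[OF Ygens_carrier])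
  show "abelian_group (line Kact)"
    by (rule abelian_groupI) (auto simp: line_def algebra_simps intro: exI[of _ "- _"] left_minus)
  show "left_module_axioms (Y_alg D) (line Kact)"
    by standard (auto simp: Y_alg_simps line_simps Y_closed algebra_simps)
qed

text \<open>Scalars are central in \<open>H\<close>, so each element of \<open>Y\<close> acts on the line by
  multiplication with its value on 1, and these values are multiplicative and prescribed on the
  generators.\<close>
lemma K_action_eq: "K_action D \<gamma> = Kact"
  unfolding K_action_def
proof (rule the_equality)
  show "Kact \<in> extensional (Y_set D) \<and> left_module (Y_alg D) (line Kact) \<and> (\<forall>c v. Kact (H_scalar D c) v = c * v) \<and>
     (\<forall>h\<in>carrier G. Kact (H_class D (letter (gen_G h))) 1 = \<gamma> h) \<and>
     (\<forall>i\<in>{1..rnk D}. Kact (H_class D (letter (gen_Y i))) 1 = 0)"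
    using Y_gens(3) eps_simps(3) by (auto simp: left_module_line Y_gens I_def)
next
  fix a assume a: "a \<in> extensional (Y_set D) \<and> left_module (Y_alg D) (line a) \<and> (\<forall>c v. a (H_scalar D c) v = c * v) \<and>
     (\<forall>h\<in>carrier G. a (H_class D (letter (gen_G h))) 1 = \<gamma> h) \<and>
     (\<forall>i\<in>{1..rnk D}. a (H_class D (letter (gen_Y i))) 1 = 0)"
  then interpret L: left_module "Y_alg D" "line a"
    by simp
  have a_add: "a (u \<oplus>\<^bsub>H_alg D\<^esub> w) v = a u v + a w v" and a_mult: "a (u \<otimes>\<^bsub>H_alg D\<^esub> w) v = a u (a w v)"
    if "u \<in> Y_set D" "w \<in> Y_set D" for u w v
    using L.smult_l_distr[of u w v] L.smult_assoc[of u w v] that by (simp_all add: Y_alg_simps line_simps)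
  have scale: "a u v = v * a u 1" if "u \<in> Y_set D" for u v
  proof -
    have "a u v = a u (a (H_scalar D v) 1)"
      using a by simp
    also have "\<dots> = a (H_scalar D v \<otimes>\<^bsub>H_alg D\<^esub> u) 1"
      using that by (simp add: a_mult[symmetric] Y_gens H_scalar_commute Y_carrier)
    also have "\<dots> = v * a u 1"
      using that a by (simp add: a_mult Y_gens)
    finally show ?thesis .
  qed
  have one: "a u 1 = eps u" if "u \<in> Y_set D" for u
    using that
  proof (induction u rule: Y_induct)
    case (mult u w)
    then show ?case
      using scale[of u "eps w"] by (simp add: a_mult)
  qed (use a in \<open>auto simp: a_add I_def\<close>)
  have "a u = Kact u" if u: "u \<in> Y_set D" for u
  proof
    show "a u v = Kact u v" for v
      unfolding scale[OF u, of v] one[OF u] using u by (simp add: mult.commute)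
  qed
  then show "a = Kact"
    using a by (intro extensionalityI[of a "Y_set D"]) simp_all
qed

lemma K_mod_simps: "carrier (K_mod D \<gamma>) = UNIV" "v \<oplus>\<^bsub>K_mod D \<gamma>\<^esub> w = v + w"
  "u \<in> Y_set D \<Longrightarrow> u \<odot>\<^bsub>K_mod D \<gamma>\<^esub> v = eps u * v"
  by (simp_all add: K_mod_def line_simps K_action_eq)

section \<open>The module \<open>Z(\<gamma>)\<close> and its submodules\<close>

sublocale Ind: induction_datum "H_alg D" "Y_set D" "K_mod D \<gamma>"
  by unfold_locales (auto simp: K_mod_simps Y_carrier)

lemma Z_mod_eq: "Z_mod D \<gamma> = Ind.Z"
  by (simp add: Z_mod_def)

abbreviation "Z \<equiv> Ind.Z"

interpretation Z: abelian_group Z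
  by (rule Ind.abelian_group_induced)

text \<open>The element \<open>p 1\<^sub>\<gamma>\<close> of \<open>Z(\<gamma>)\<close>.\<close>
definition on_gen :: "('g generator list \<Rightarrow>\<^sub>0 'k) \<Rightarrow> (('g generator list \<Rightarrow>\<^sub>0 'k) set \<times> 'k \<Rightarrow>\<^sub>0 int) set" where
  "on_gen p = Ind.pure (H_class D p) 1"

lemma on_gen_closed [simp]: "p \<in> FA \<Longrightarrow> on_gen p \<in> carrier Z"
  by (simp add: on_gen_def K_mod_simps)

lemma on_gen_add: "p \<in> FA \<Longrightarrow> r \<in> FA \<Longrightarrow> on_gen (p + r) = on_gen p \<oplus>\<^bsub>Z\<^esub> on_gen r"
  by (simp add: on_gen_def H_class_add Ind.pure_add_left K_mod_simps)

lemma on_gen_zero: "on_gen 0 = \<zero>\<^bsub>Z\<^esub>"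
  using on_gen_add[of 0 0] Z.add.r_cancel_one'[of "on_gen 0" "on_gen 0"] by simp

lemma on_gen_uminus: "p \<in> FA \<Longrightarrow> on_gen (- p) = \<ominus>\<^bsub>Z\<^esub> on_gen p"
  using on_gen_add[of "- p" p] by (intro Z.minus_equality[symmetric]) (auto simp: on_gen_zero)

lemma on_gen_smult: "r \<in> FA \<Longrightarrow> p \<in> FA \<Longrightarrow> H_class D r \<odot>\<^bsub>Z\<^esub> on_gen p = on_gen (r * p)"
  by (simp add: on_gen_def Ind.smult_pure K_mod_simps H_class_mult)

lemma pure_eq_on_gen: "p \<in> FA \<Longrightarrow> Ind.pure (H_class D p) c = on_gen (fconst c * p)"
  using Ind.pure_balanced[of "H_class D p" "H_scalar D c" 1]
  by (simp add: on_gen_def K_mod_simps Y_gens H_scalar_commute) (simp add: H_scalar_def H_class_mult)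

lemma on_gen_Y: "p \<in> FA \<Longrightarrow> s \<in> FA \<Longrightarrow> H_class D s \<in> Y_set D \<Longrightarrow> on_gen (p * s) = on_gen (fconst (eps (H_class D s)) * p)"
  using Ind.pure_balanced[of "H_class D p" "H_class D s" 1]
  by (simp add: pure_eq_on_gen[symmetric] K_mod_simps) (simp add: on_gen_def H_class_mult)

lemma on_gen_H_ideal: "p \<in> H_ideal D \<Longrightarrow> on_gen p = \<zero>\<^bsub>Z\<^esub>"
  using H_class_eqI[of p 0] H_ideal_FA[of p] by (simp add: on_gen_def flip: on_gen_zero)

lemma on_gen_surj:
  assumes "z \<in> carrier Z"
  shows "\<exists>p\<in>FA. z = on_gen p"
  using assms
proof (induction z rule: Ind.induced_induct)
  case (pure r v)
  then show ?case
    by (elim H_class_surj) (metis pure_eq_on_gen FA_mult FA_fconst)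
next
  case (add z z')
  then show ?case
    by (metis on_gen_add FA_add)
next
  case (minus z)
  then show ?case
    by (metis on_gen_uminus FA_uminus)
next
  case zero
  show ?case
    by (metis on_gen_zero FA_0)
qed

text \<open>The universal property applies because \<open>Y\<close> acts on \<open>v0\<close> through \<open>eps\<close>, as it does on \<open>k\<^sub>\<gamma>\<close>.\<close>
lemma obtain_theta:
  obtains \<theta> where "additive_map Z \<theta>" "\<And>p. p \<in> FA \<Longrightarrow> \<theta> (on_gen p) = act p v0"
proof -
  obtain \<theta> where \<theta>: "additive_map Z \<theta>"
    "\<And>u c. u \<in> carrier (H_alg D) \<Longrightarrow> c \<in> carrier (K_mod D \<gamma>) \<Longrightarrow> \<theta> (Ind.pure u c) = fscale c (Hact u v0)"
    by (rule Ind.induced_lift[of "\<lambda>u c. fscale c (Hact u v0)"])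
      (auto simp: Hact_add K_mod_simps Hact_mult Hact_Y Hact_scale Y_carrier mult.commute)
  show ?thesis
  proof
    show "additive_map Z \<theta>" by (rule \<theta>(1))
    show "\<theta> (on_gen p) = act p v0" if "p \<in> FA" for p
      using that by (simp add: on_gen_def \<theta>(2) K_mod_simps Hact_class)
  qed
qed

lemma highest_weight_submodule:
  assumes "Module.submodule M (H_alg D) Z"
  shows "highest_weight {p \<in> FA. on_gen p \<in> M}"
proof -
  interpret M: Module.submodule M "H_alg D" Z by (rule assms)
  have zero: "\<zero>\<^bsub>Z\<^esub> \<in> M"
    using M.one_closed by simp
  have add: "z \<oplus>\<^bsub>Z\<^esub> z' \<in> M" if "z \<in> M" "z' \<in> M" for z z'
    using M.m_closed[OF that] by simp
  have diff: "on_gen (p - r) = \<zero>\<^bsub>Z\<^esub>" if "p \<in> FA" "r \<in> FA" "on_gen p = on_gen r" for p r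
    using on_gen_add[of p "- r"] on_gen_uminus[of r] that Z.r_neg[of "on_gen r"] by simp
  show ?thesis
    unfolding highest_weight_def
  proof (intro conjI ballI)
    show "H_ideal D \<subseteq> {p \<in> FA. on_gen p \<in> M}"
      using H_ideal_FA on_gen_H_ideal zero by auto
    show "p + r \<in> {p \<in> FA. on_gen p \<in> M}" if "p \<in> {p \<in> FA. on_gen p \<in> M}" "r \<in> {p \<in> FA. on_gen p \<in> M}" for p r
      using that add by (simp add: on_gen_add)
    show "r * p \<in> {p \<in> FA. on_gen p \<in> M}" if "r \<in> FA" "p \<in> {p \<in> FA. on_gen p \<in> M}" for p r
      using that M.smult_closed[of "H_class D r" "on_gen p"] by (simp add: on_gen_smult)
    show "letter (gen_G h) - fconst (\<gamma> h) \<in> {p \<in> FA. on_gen p \<in> M}" if "h \<in> carrier G" for h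
      using on_gen_Y[of 1 "letter (gen_G h)"] Y_gens(2)[OF that] that zero by (simp add: diff)
    show "letter (gen_Y i) \<in> {p \<in> FA. on_gen p \<in> M}" if "i \<in> I" for i
      using on_gen_Y[of 1 "letter (gen_Y i)"] Y_gens(3)[OF that] that zero by (simp add: fconst_simps on_gen_zero)
  qed auto
qed

section \<open>The dimension of the simple quotient\<close>

lemma card_B_split: "card B = (\<Prod>k\<in>{1..rnk D} - S_set D \<gamma>. mord D k) * (\<Prod>j\<in>S_set D \<gamma>. e_exp D \<gamma> j + 1)"
proof -
  have S: "S_set D \<gamma> \<subseteq> I"
    by (auto simp: S_set_def I_def)
  have "card B = (\<Prod>k\<in>I - S_set D \<gamma>. bound k) * (\<Prod>k\<in>S_set D \<gamma>. bound k)"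
    unfolding card_B by (rule prod.subset_diff[OF S]) simp
  moreover have "(\<Prod>k\<in>I - S_set D \<gamma>. bound k) = (\<Prod>k\<in>I - S_set D \<gamma>. m k)"
    by (rule prod.cong) (auto simp: bound_def)
  ultimately show ?thesis
    by (simp add: bound_def I_def)
qed

lemma dim_L:
  "vectorspace.fin_dim class_ring (restrict_scalars (H_scalar D) (L_mod D \<gamma>)) \<and>
    vectorspace.dim class_ring (restrict_scalars (H_scalar D) (L_mod D \<gamma>)) = card B"
proof -
  obtain \<theta> where \<theta>: "additive_map Z \<theta>" "\<And>p. p \<in> FA \<Longrightarrow> \<theta> (on_gen p) = act p v0"
    by (rule obtain_theta) (rule that)
  interpret \<theta>: additive_map Z \<theta> by (rule \<theta>(1))
  have smult_closed: "u \<odot>\<^bsub>Z\<^esub> z \<in> carrier Z" if "u \<in> carrier (H_alg D)" "z \<in> carrier Z" for u z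
    using that on_gen_surj[OF that(2)] by (elim H_class_surj) (auto simp: on_gen_smult)
  have \<theta>_smult: "\<theta> (u \<odot>\<^bsub>Z\<^esub> z) = Hact u (\<theta> z)" if "u \<in> carrier (H_alg D)" "z \<in> carrier Z" for u z
    using that on_gen_surj[OF that(2)] by (elim H_class_surj) (auto simp: on_gen_smult \<theta>(2) Hact_class)
  have Hact_0: "Hact u 0 = 0" if "u \<in> carrier (H_alg D)" for u
    using Hact_scale[OF that, of 0 0] by simp
  let ?R = "\<theta>.fibre 0"
  have sub: "Module.submodule ?R (H_alg D) Z"
  proof (intro Module.submodule.intro Module.submodule_axioms.intro)
    show "subgroup ?R (add_monoid Z)"
      by (rule group.subgroupI[OF Z.a_group])
        (auto simp: \<theta>.fibre_def \<theta>.\<theta>_add \<theta>.\<theta>_minus \<theta>.\<theta>_zero intro: exI[of _ "\<zero>\<^bsub>Z\<^esub>"] simp flip: a_inv_def)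
    show "u \<odot>\<^bsub>Z\<^esub> z \<in> ?R" if "u \<in> carrier (H_alg D)" "z \<in> ?R" for u z
      using that by (auto simp: \<theta>.fibre_def smult_closed \<theta>_smult Hact_0)
  qed
  have v0: "v0 \<noteq> 0"
    by (metis delta_def zero_fun_apply zero_neq_one)
  \<comment> \<open>Every submodule outside the kernel of \<open>\<theta>\<close> is everything. Hence the kernel is maximal, and it is the only maximal submodule.\<close>
  have key: "M = carrier Z" if M: "Module.submodule M (H_alg D) Z" and "\<not> M \<subseteq> ?R" for M
  proof -
    interpret M: Module.submodule M "H_alg D" Z by (rule M)
    have MZ: "M \<subseteq> carrier Z"
      using M.subset by simp
    obtain z where z: "z \<in> M" "\<theta> z \<noteq> 0"
      using \<open>\<not> M \<subseteq> ?R\<close> MZ by (auto simp: \<theta>.fibre_def)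
    then obtain p where p: "p \<in> FA" "z = on_gen p"
      using on_gen_surj MZ by blast
    have "1 \<in> {p \<in> FA. on_gen p \<in> M}"
      by (rule one_in_highest_weight[OF highest_weight_submodule[OF M], of p]) (use p z \<theta>(2) in auto)
    then have "on_gen 1 \<in> M"
      by simp
    then have "on_gen r \<in> M" if "r \<in> FA" for r
      using M.smult_closed[of "H_class D r" "on_gen 1"] that by (simp add: on_gen_smult)
    then show ?thesis
      using MZ on_gen_surj by blast
  qed
  have "on_gen 1 \<notin> ?R" "on_gen 1 \<in> carrier Z"
    using v0 \<theta>(2)[of 1] on_gen_closed[of 1] by (simp_all add: \<theta>.fibre_def)
  then have ne: "?R \<noteq> carrier Z"
    by blast
  have R_sub: "R_sub D \<gamma> = ?R"
    unfolding R_sub_def Z_mod_eq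
  proof (rule the_equality)
    show "maximal_submodule (H_alg D) Z ?R"
      unfolding maximal_submodule_def using sub ne key by blast
    show "M = ?R" if "maximal_submodule (H_alg D) Z M" for M
      using that sub ne key unfolding maximal_submodule_def by blast
  qed
  let ?L = "quotient_module Z ?R" and ?W = "restrict_scalars (H_scalar D) (L_mod D \<gamma>)"
  have W: "carrier ?W = carrier ?L" "add ?W = add ?L" "\<zero>\<^bsub>?W\<^esub> = ?R" "c \<odot>\<^bsub>?W\<^esub> C = H_scalar D c \<odot>\<^bsub>?L\<^esub> C" for c C
    by (simp_all add: restrict_scalars_def L_mod_def R_sub Z_mod_eq quotient_module_def)
  have reach: "\<exists>z\<in>carrier Z. \<theta> z = f" if "boxed f" for f
    using boxed_reached[OF that] \<theta>(2) on_gen_closed by metis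
  have boxed_\<theta>: "boxed (\<theta> z)" if "z \<in> carrier Z" for z
    using on_gen_surj[OF that] \<theta>(2) boxed_act[OF _ boxed_delta[OF origin_B]] by auto
  have L_carrier: "carrier ?L = \<theta>.fibre ` {f. boxed f}"
    unfolding \<theta>.carrier_quotient using reach boxed_\<theta> by (auto simp: image_iff)
  let ?n = "card B"
  \<comment> \<open>The quotient is identified with coordinate vectors by enumerating the box.\<close>
  obtain ix where ix: "bij_betw ix B {0..<?n}"
    using ex_bij_betw_finite_nat[OF finite_B] by blast
  then have ix_less: "ix \<beta> < ?n" if "\<beta> \<in> B" for \<beta>
    using that by (auto simp: bij_betw_def)
  define F :: "'k vec \<Rightarrow> (nat \<Rightarrow> nat) \<Rightarrow> 'k" where "F v = (\<lambda>\<beta>. if \<beta> \<in> B then v $ ix \<beta> else 0)" for v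
  have F_boxed: "boxed (F v)" for v
    by (simp add: F_def boxed_def)
  have F_bij: "bij_betw F (carrier_vec ?n) {f. boxed f}"
  proof (rule bij_betw_byWitness[where f' = "\<lambda>f. vec ?n (\<lambda>i. f (inv_into B ix i))"])
    show "\<forall>v\<in>carrier_vec ?n. vec ?n (\<lambda>i. F v (inv_into B ix i)) = v"
      using bij_betw_inv_into_right[OF ix] bij_betwE[OF bij_betw_inv_into[OF ix]]
      by (auto simp: F_def intro!: eq_vecI)
    show "\<forall>f\<in>{f. boxed f}. F (vec ?n (\<lambda>i. f (inv_into B ix i))) = f"
      using bij_betw_inv_into_left[OF ix] by (auto simp: F_def boxed_def ix_less intro!: ext)
  qed (auto simp: F_boxed)
  have fibre_inj: "inj_on \<theta>.fibre {f. boxed f}"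
    using reach by (intro inj_onI) (fastforce simp: \<theta>.fibre_def)
  have bij: "bij_betw (\<theta>.fibre \<circ> F) (carrier (module_vec TYPE('k) ?n)) (carrier ?W)"
    unfolding W L_carrier using F_bij fibre_inj
    by (auto simp: module_vec_simps intro!: bij_betw_trans inj_on_imp_bij_betw)
  have fibre_F_add: "\<theta>.fibre (F u) \<oplus>\<^bsub>?L\<^esub> \<theta>.fibre (F v) = \<theta>.fibre (F u + F v)" for u v
    using reach[OF F_boxed[of u]] reach[OF F_boxed[of v]] by (metis \<theta>.fibre_add)
  have fibre_F_smult: "H_scalar D c \<odot>\<^bsub>?L\<^esub> \<theta>.fibre (F v) = \<theta>.fibre (fscale c (F v))" for c v
  proof -
    obtain z where "z \<in> carrier Z" "\<theta> z = F v"
      using reach[OF F_boxed[of v]] by blast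
    then show ?thesis
      using \<theta>.fibre_smult[of z "H_scalar D c" "fscale c"] by (simp add: smult_closed \<theta>_smult)
  qed
  have zero: "(\<theta>.fibre \<circ> F) \<zero>\<^bsub>module_vec TYPE('k) ?n\<^esub> = \<zero>\<^bsub>?W\<^esub>"
  proof -
    have "F (0\<^sub>v ?n) = 0"
      by (auto simp: F_def ix_less zero_fun_apply intro!: ext)
    then show ?thesis
      unfolding W by (simp add: module_vec_simps)
  qed
  have add: "(\<theta>.fibre \<circ> F) (u \<oplus>\<^bsub>module_vec TYPE('k) ?n\<^esub> v) = (\<theta>.fibre \<circ> F) u \<oplus>\<^bsub>?W\<^esub> (\<theta>.fibre \<circ> F) v"
    if uv: "u \<in> carrier (module_vec TYPE('k) ?n)" "v \<in> carrier (module_vec TYPE('k) ?n)" for u v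
  proof -
    have "F (u + v) = F u + F v"
      using uv by (auto simp: F_def ix_less plus_fun_apply module_vec_simps intro!: ext)
    then show ?thesis
      unfolding W using fibre_F_add by (simp add: module_vec_simps)
  qed
  have smult: "(\<theta>.fibre \<circ> F) (c \<odot>\<^bsub>module_vec TYPE('k) ?n\<^esub> v) = c \<odot>\<^bsub>?W\<^esub> (\<theta>.fibre \<circ> F) v"
    if v: "v \<in> carrier (module_vec TYPE('k) ?n)" for c v
  proof -
    have "F (c \<cdot>\<^sub>v v) = fscale c (F v)"
      using v by (auto simp: F_def ix_less fscale_def module_vec_simps intro!: ext)
    then show ?thesis
      unfolding W using fibre_F_smult by (simp add: module_vec_simps)
  qed
  have "vectorspace.fin_dim class_ring ?W"
    by (rule vectorspace_transport(2)[OF vec_vs bij zero])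
      ((rule add, assumption+ | rule smult, assumption | rule vec_space.fin_dim)+)
  moreover have "vectorspace.dim class_ring ?W = vectorspace.dim class_ring (module_vec TYPE('k) ?n)"
    by (rule vectorspace_transport(3)[OF vec_vs bij zero])
      ((rule add, assumption+ | rule smult, assumption | rule vec_space.fin_dim)+)
  ultimately show ?thesis
    by (simp add: vec_space.dim_is_n)
qed

end

theorem corollary3p6:
  fixes D :: "('g, 'k::field_char_0) datum" and \<gamma> :: "'g \<Rightarrow> 'k"
  assumes "contains_roots_of_unity TYPE('k)"
    and "simply_linked_datum D"
    and "\<gamma> \<in> characters (grp D)"
  shows "vectorspace.fin_dim class_ring (restrict_scalars (H_scalar D) (L_mod D \<gamma>)) \<and>
    vectorspace.dim class_ring (restrict_scalars (H_scalar D) (L_mod D \<gamma>)) =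
      (\<Prod>k\<in>{1..rnk D} - S_set D \<gamma>. mord D k) * (\<Prod>j\<in>S_set D \<gamma>. e_exp D \<gamma> j + 1)"
proof -
  interpret linked_datum D \<gamma>
    by unfold_locales (fact assms)+
  show ?thesis
    using dim_L by (simp only: card_B_split)
qed

end
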